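(* Consider the distributed problem of minimizing $f=\sum_{i\in V}f_i$ over $X=\bigcap_{i\in V}X_i$ and the random projected proximal algorithm described in the context. Assume: (1) each $X_i^j\subset\mathbb{R}^d$ ($i\in V$, $j\in I_i$) is closed and convex, and $X\neq\emptyset$; each $f_i:\mathbb{R}^d\to\mathbb{R}$ is convex; for each $i\in V$ there is $M_i\in\mathbb{R}$ with $\|g\|\le M_i$ for all $x\in X_i$ and all $g\in\partial f_i(x)$; (2) there is an integer $Q\ge 1$ such that for every $k\ge 0$ the directed graph $(V,\bigcap_{l=0}^{Q-1}E(k+l))$ is strongly connected; (3) the random variables $\Omega_i(k)$ ($i\in V$, $k\ge0$) are independent, and independent of the initial points $x_i(0)$ ($i\in V$); for each $i$ the variables $\Omega_i(k)$, $k\ge 0$, are identically distributed; and $\Pr\{\Omega_i(k)=j\}>0$ for all $i\in V$, $j\in I_i$; (4) there is $c>0$ such that $\mathrm{d}(x,X)^2\le c\,\mathrm{E}[\mathrm{d}(x,X_i^{\Omega_i(k)})^2]$ for all $i\in V$, $x\in\mathbb{R}^d$, $k\ge 0$; (5) for all $k\ge 0$: $w_{ij}(k)\ge 0$ for all $i,j\in V$, $w_{ij}(k)=0$ if $j\notin N_i(k)$, $\sum_{j\in V}w_{ij}(k)=1$ for all $i$, and $\sum_{i\in V}w_{ij}(k)=1$ for all $j$; moreover there is $w\in(0,1)$ with $w_{ij}(k)\ge w$ for all $i\in V$, $k\ge0$, $j\in N_i(k)$; and $(\alpha_k)_{k\ge0}\subset(0,\infty)$ satisfies $\sum_{k}\alpha_k=\infty$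 and $\sum_k\alpha_k^2<\infty$. Let $x^\star\in X^\star$ and let $(x_i(k))_{k\ge0}$ ($i\in V$) be generated by the algorithm. Then there exist constants $\beta^{(j)}>0$ ($j=1,\dots,5$) such that, almost surely, for all $k\ge0$, $$\mathrm{E}\Big[\sum_{i=1}^m\mathrm{d}(x_i(k+1),X)^2\,\Big|\,\mathcal{F}_k\Big]\le\sum_{i=1}^m\mathrm{d}(x_i(k),X)^2-\sum_{j=1,2}\beta^{(j)}\gamma_k^{(j)}+\beta^{(3)}\gamma_k^{(3)},$$ $$\mathrm{E}\Big[\sum_{i=1}^m\|x_i(k+1)-x^\star\|^2\,\Big|\,\mathcal{F}_k\Big]\le\sum_{i=1}^m\|x_i(k)-x^\star\|^2-\sum_{j=1,2,5}\beta^{(j)}\gamma_k^{(j)}+\sum_{j=3,4}\beta^{(j)}\gamma_k^{(j)},$$ where $\gamma_k^{(1)}:=\sum_{i=1}^m\mathrm{d}(v_i(k),X)^2$, $\gamma_k^{(2)}:=\sum_{i=1}^m\|v_i(k)-\mathrm{prox}_{\alpha_kf_i}(v_i(k))\|^2$, $\gamma_k^{(3)}:=\alpha_k^2$, $\gamma_k^{(4)}:=\alpha_k\sum_{i=1}^m\|v_i(k)-\bar v(k)\|$, $\gamma_k^{(5)}:=\alpha_k(f(\bar z(k))-f^\star)$; and $\sum_{k=0}^\infty\gamma_k^{(j)}<\infty$ almost surely for $j=1,2,3,4,5$.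
   Context: Setting. $V=\{1,\dots,m\}$ is a set of users. $I=\{1,\dots,n\}$ is the disjoint union of nonempty sets $I_i$ ($i\in V$). User $i$ has a function $f_i:\mathbb{R}^d\to\mathbb{R}$ and sets $X_i^j\subset\mathbb{R}^d$ ($j\in I_i$); $X_i:=\bigcap_{j\in I_i}X_i^j$, $X:=\bigcap_{i\in V}X_i$, $f:=\sum_{i\in V}f_i$, $f^\star:=\inf_{x\in X}f(x)$, $X^\star:=\{x\in X: f(x)=f^\star\}$, assumed nonempty. Notation. $\mathbb{R}^d$ carries the Euclidean norm. For a nonempty closed convex $C$, $P_C$ is the metric (nearest-point) projection onto $C$ and $\mathrm{d}(x,C)=\inf_{y\in C}\|x-y\|$. $\partial f_i$ is the convex subdifferential. $\mathrm{prox}_{g}(x)$ is the unique minimizer over $y\in\mathbb{R}^d$ of $g(y)+\frac12\|x-y\|^2$. Network. At each time $k\ge0$ there is a directed graph $(V,E(k))$, $E(k)\subset V\times V$, where $(i,j)\in E(k)$ means $i$ receives information from $j$; $N_i(k):=\{j\in V:(i,j)\in E(k)\}$, and $i\in N_i(k)$ always. $w_{ij}(k)$ are weights and $\alpha_k>0$ step sizes (deterministic). $\Omega_i(k)$ is a random variable with values in $I_i$. Algorithm (random projected proximal algorithm). Initial points $x_i(0)\in\mathbb{R}^d$ ($i\in V$) are arbitrary (possibly random). For $k\ge0$ and $i\in V$, $$v_i(k):=\sum_{j\in N_i(k)}w_{ij}(k)x_j(k),\qquad x_i(k+1):=P_{X_i^{\Omega_i(k)}}\big(\mathrm{prox}_{\alpha_kf_i}(v_i(k))\big).$$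 $\mathcal{F}_k$ is the $\sigma$-algebra generated by $x_i(0)$ ($i\in V$) and $\Omega_i(l)$ ($i\in V$, $0\le l\le k-1$). Further, $\bar v(k):=\frac1m\sum_{l=1}^mv_l(k)$, $z_i(k):=P_X(v_i(k))$, $\bar z(k):=\frac1m\sum_{i=1}^mz_i(k)$. *)

theory Defs
  imports "HOL-Probability.Probability" "Graph_Theory.Digraph_Component"
begin

definition subdifferential :: "('a::real_inner \<Rightarrow> real) \<Rightarrow> 'a \<Rightarrow> 'a set" where
  "subdifferential f x = {g. \<forall>y. f y \<ge> f x + g \<bullet> (y - x)}"

definition prox :: "('a::real_normed_vector \<Rightarrow> real) \<Rightarrow> 'a \<Rightarrow> 'a" where
  "prox g x = (THE y. is_arg_min (\<lambda>y. g y + (norm (x - y))\<^sup>2 / 2) (\<lambda>_. True) y)"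

text \<open>The users are \<open>{1..m}\<close>; \<open>I i\<close> is the index set of the constraint sets \<open>Xs i j\<close> of user \<open>i\<close>.\<close>

definition user_feasible :: "(nat \<Rightarrow> nat set) \<Rightarrow> (nat \<Rightarrow> nat \<Rightarrow> 'a set) \<Rightarrow> nat \<Rightarrow> 'a set" where
  "user_feasible I Xs i = (\<Inter>j\<in>I i. Xs i j)"

definition feasible :: "nat \<Rightarrow> (nat \<Rightarrow> nat set) \<Rightarrow> (nat \<Rightarrow> nat \<Rightarrow> 'a set) \<Rightarrow> 'a set" where
  "feasible m I Xs = (\<Inter>i\<in>{1..m}. user_feasible I Xs i)"

definition total_cost :: "nat \<Rightarrow> (nat \<Rightarrow> 'a \<Rightarrow> real) \<Rightarrow> 'a \<Rightarrow> real" where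
  "total_cost m f x = (\<Sum>i=1..m. f i x)"

text \<open>The infimum is taken in \<^typ>\<open>ereal\<close>: on \<^typ>\<open>real\<close>, the infimum of a set that is unbounded below
  is an unspecified number, which a feasible point might happen to attain.\<close>

definition optimal_value :: "('a \<Rightarrow> real) \<Rightarrow> 'a set \<Rightarrow> ereal" where
  "optimal_value F X = (INF x\<in>X. ereal (F x))"

definition solutions :: "('a \<Rightarrow> real) \<Rightarrow> 'a set \<Rightarrow> 'a set" where
  "solutions F X = {x \<in> X. ereal (F x) = optimal_value F X}"

text \<open>An arc \<open>(i, j)\<close> means that \<open>i\<close> receives information from \<open>j\<close>.\<close>

definition user_graph :: "nat \<Rightarrow> (nat \<times> nat) set \<Rightarrow> (nat, nat \<times> nat) pre_digraph" where
  "user_graph m A = \<lparr>verts = {1..m}, arcs = A, tail = fst, head = snd\<rparr>"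

definition neighbours :: "nat \<Rightarrow> (nat \<Rightarrow> (nat \<times> nat) set) \<Rightarrow> nat \<Rightarrow> nat \<Rightarrow> nat set" where
  "neighbours m E i k = {j \<in> {1..m}. (i, j) \<in> E k}"

text \<open>In the processes \<open>x\<close>, \<open>v\<close>, \<open>\<Omega>\<close>, the arguments are the user, the time and the sample point.\<close>

definition random_projected_proximal ::
  "'w measure \<Rightarrow> nat \<Rightarrow> (nat \<Rightarrow> (nat \<times> nat) set) \<Rightarrow> (nat \<Rightarrow> nat \<Rightarrow> nat \<Rightarrow> real)
    \<Rightarrow> (nat \<Rightarrow> 'a \<Rightarrow> real) \<Rightarrow> (nat \<Rightarrow> nat \<Rightarrow> 'a set) \<Rightarrow> (nat \<Rightarrow> real) \<Rightarrow> (nat \<Rightarrow> nat \<Rightarrow> 'w \<Rightarrow> nat)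
    \<Rightarrow> (nat \<Rightarrow> nat \<Rightarrow> 'w \<Rightarrow> 'a::euclidean_space) \<Rightarrow> (nat \<Rightarrow> nat \<Rightarrow> 'w \<Rightarrow> 'a) \<Rightarrow> bool" where
  "random_projected_proximal M m E w f Xs \<alpha> \<Omega> x v \<longleftrightarrow>
    (\<forall>i\<in>{1..m}. \<forall>k. \<forall>\<omega>\<in>space M.
      v i k \<omega> = (\<Sum>j\<in>neighbours m E i k. w i j k *\<^sub>R x j k \<omega>) \<and>
      x i (Suc k) \<omega> = closest_point (Xs i (\<Omega> i k \<omega>)) (prox (\<lambda>y. \<alpha> k * f i y) (v i k \<omega>)))"

definition events_of :: "'w measure \<Rightarrow> 'b measure \<Rightarrow> ('i \<Rightarrow> 'w \<Rightarrow> 'b) \<Rightarrow> 'i set \<Rightarrow> 'w set set" where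
  "events_of M N Y J = {Y i -` A \<inter> space M | i A. i \<in> J \<and> A \<in> sets N}"

definition initial_events ::
  "'w measure \<Rightarrow> nat \<Rightarrow> (nat \<Rightarrow> nat \<Rightarrow> 'w \<Rightarrow> 'a::topological_space) \<Rightarrow> 'w set set" where
  "initial_events M m x = events_of M borel (\<lambda>i. x i 0) {1..m}"

definition selection_events ::
  "'w measure \<Rightarrow> nat \<Rightarrow> (nat \<Rightarrow> nat \<Rightarrow> 'w \<Rightarrow> nat) \<Rightarrow> nat set \<Rightarrow> 'w set set" where
  "selection_events M m \<Omega> T =
    events_of M (count_space UNIV) (\<lambda>(i, l). \<Omega> i l) ({1..m} \<times> T)"

text \<open>The \<open>\<sigma>\<close>-algebra \<open>\<F>\<^sub>k\<close>, as a measurable space on the sample space of \<open>M\<close>.\<close>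

definition history ::
  "'w measure \<Rightarrow> nat \<Rightarrow> (nat \<Rightarrow> nat \<Rightarrow> 'w \<Rightarrow> 'a::topological_space)
    \<Rightarrow> (nat \<Rightarrow> nat \<Rightarrow> 'w \<Rightarrow> nat) \<Rightarrow> nat \<Rightarrow> 'w measure" where
  "history M m x \<Omega> k =
    sigma (space M) (initial_events M m x \<union> selection_events M m \<Omega> {..<k})"

text \<open>Conditional expectation of a nonnegative real random variable that need not be integrable
  (the initial points are arbitrary), with values in \<open>[0, \<infinity>]\<close>, embedded into \<^typ>\<open>ereal\<close> so that
  it can be compared with a real bound of either sign.\<close>

definition cond_exp :: "'w measure \<Rightarrow> 'w measure \<Rightarrow> ('w \<Rightarrow> real) \<Rightarrow> 'w \<Rightarrow> ereal" where
  "cond_exp M F Y \<omega> = enn2ereal (nn_cond_exp M F (\<lambda>\<omega>. ennreal (Y \<omega>)) \<omega>)"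

definition average :: "nat \<Rightarrow> (nat \<Rightarrow> 'a::real_vector) \<Rightarrow> 'a" where
  "average m u = (1 / real m) *\<^sub>R (\<Sum>i=1..m. u i)"

text \<open>The value at \<open>j \<in> {1..5}\<close> is the \<open>j\<close>-th of the quantities \<open>\<gamma>\<^sub>k\<close>, for \<open>a = \<alpha>\<^sub>k\<close> and \<open>u i = v\<^sub>i(k)\<close>.\<close>

definition gamma ::
  "nat \<Rightarrow> (nat \<Rightarrow> 'a::euclidean_space \<Rightarrow> real) \<Rightarrow> 'a set \<Rightarrow> real \<Rightarrow> (nat \<Rightarrow> 'a) \<Rightarrow> nat \<Rightarrow> real" where
  "gamma m f X a u j =
    (if j = 1 then \<Sum>i=1..m. (infdist (u i) X)\<^sup>2
     else if j = 2 then \<Sum>i=1..m. (norm (u i - prox (\<lambda>y. a * f i y) (u i)))\<^sup>2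
     else if j = 3 then a\<^sup>2
     else if j = 4 then a * (\<Sum>i=1..m. norm (u i - average m u))
     else a * (total_cost m f (average m (\<lambda>i. closest_point X (u i)))
               - real_of_ereal (optimal_value (total_cost m f) X)))"

end

theory Submission
  imports Defs
begin

text \<open>
  Put \<open>p\<^sub>i = prox\<close> of \<open>v\<^sub>i\<close>. The variational inequality of the proximal point and the obtuse angle
  property of the projection bound \<open>\<parallel>x\<^sub>i(k+1) - y\<parallel>\<^sup>2\<close> for every feasible \<open>y\<close>, with a gain of
  \<open>\<parallel>v\<^sub>i - p\<^sub>i\<parallel>\<^sup>2\<close> and of the squared distance of \<open>v\<^sub>i\<close> to the randomly chosen set. As \<open>\<Omega>\<^sub>i(k)\<close> is
  independent of the past, regularity turns the conditional expectation of the latter into a multiple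
  of the squared distance to \<open>X\<close>. Taking \<open>y = z\<^sub>i\<close> gives the first inequality and \<open>y = x\<^sup>*\<close> the second.

  Summability needs no martingale convergence theorem. The initial points may fail to be integrable,
  but the events on which all \<open>\<parallel>x\<^sub>i(0)\<parallel> \<le> N\<close> belong to every \<open>\<F>\<^sub>k\<close> and exhaust the sample space, and
  on each of them the integrated inequalities telescope. The first one yields that the integrals of
  \<open>\<gamma>\<^sup>1\<close> and \<open>\<gamma>\<^sup>2\<close> are summable. These two control \<open>\<parallel>x\<^sub>i(k+1) - v\<^sub>i(k)\<parallel>\<^sup>2\<close>; since each graph is
  strongly connected, one averaging step contracts the variance of the users' points by a fixed factor,
  so the integrals of the disagreement \<open>\<Sum>\<^sub>i \<parallel>v\<^sub>i - v'\<parallel>\<^sup>2\<close>, where \<open>v'\<close> is the average, are summable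
  too. By the arithmetic-geometric mean inequality so are those of \<open>\<gamma>\<^sup>4\<close>, and the second inequality
  then gives \<open>\<gamma>\<^sup>5\<close>.
\<close>

section \<open>Subgradients, proximal points and projections\<close>

text \<open>The strict epigraph \<open>T\<close> is convex and misses the point
  \<open>(z, f z)\<close>, so a hyperplane with normal \<open>(a, s)\<close> separates them. Once
  \<open>s > 0\<close> is known, the hyperplane is the graph of an affine minorant of slope
  \<open>- a / s\<close> touching \<open>f\<close> at \<open>z\<close>.\<close>

lemma subgradient_exists:
  fixes f :: "'a::euclidean_space \<Rightarrow> real"
  assumes "convex_on UNIV f"
  shows "\<exists>g. g \<in> subdifferential f z"
proof -
  define T where "T = {(y, t). f y < t}"
  have "convex T"
    unfolding convex_alt T_def
  proof clarsimp
    fix y s y' s' and u :: real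
    assume H: "f y < s" "f y' < s'" "0 \<le> u" "u \<le> 1"
    have "f ((1 - u) *\<^sub>R y + u *\<^sub>R y') \<le> (1 - u) * f y + u * f y'"
      using convex_onD[OF assms H(3,4)] by auto
    also have "\<dots> < (1 - u) * s + u * s'"
    \<comment> \<open>Strictness comes from the second point when \<open>u > 0\<close>, and from the
      first one when \<open>u = 0\<close>.\<close>
    proof (cases "u = 0")
      case False
      then have "u * f y' < u * s'" using H by simp
      moreover have "(1 - u) * f y \<le> (1 - u) * s" using H by (intro mult_left_mono) auto
      ultimately show ?thesis by simp
    qed (use H in auto)
    finally show "f ((1 - u) *\<^sub>R y + u *\<^sub>R y') < (1 - u) * s + u * s'" .
  qed
  moreover have "(z, f z + 1) \<in> T" "{(z, f z)} \<inter> T = {}"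
    by (auto simp: T_def)
  ultimately obtain c b where "c \<noteq> 0" and z: "c \<bullet> (z, f z) \<le> b" and T: "\<forall>y\<in>T. c \<bullet> y \<ge> b"
    using separating_hyperplane_sets[of "{(z, f z)}" T] by (metis convex_singleton empty_iff insert_not_empty singletonI)
  obtain a s where c: "c = (a, s)" by (cases c)
  have sep: "a \<bullet> z + s * f z \<le> a \<bullet> y + s * t" if "t > f y" for y t
    using z T that by (auto simp: c T_def inner_Pair split: prod.splits)
      (smt (verit) inner_Pair inner_real_def)
  \<comment> \<open>Raising the second coordinate shows \<open>s \<ge> 0\<close>. A vertical
    hyperplane is impossible because \<open>f\<close> is finite everywhere: with
    \<open>s = 0\<close>, testing at \<open>z - a\<close> forces \<open>a = 0\<close>, so the normal
    would vanish.\<close>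
  have s: "s > 0"
  proof (rule ccontr)
    assume "\<not> s > 0"
    moreover have "s \<ge> 0" using sep[of z "f z + 1"] by (simp add: algebra_simps)
    ultimately have "s = 0" by simp
    then have "a \<bullet> a \<le> 0" using sep[of "z - a" "f (z - a) + 1"] by (simp add: inner_diff_right)
    then have "a = 0" by (metis inner_eq_zero_iff inner_ge_zero order_antisym)
    with \<open>s = 0\<close> c \<open>c \<noteq> 0\<close> show False by (simp add: zero_prod_def)
  qed
  have "f z + (- (1 / s) *\<^sub>R a) \<bullet> (y - z) \<le> f y" for y
  \<comment> \<open>The epigraph is strict, so the separation speaks only of heights above
    \<open>f y\<close>; the slack \<open>e\<close> goes to zero.\<close>
  proof (rule field_le_epsilon)
    fix e :: real assume "e > 0"
    then show "f z + (- (1 / s) *\<^sub>R a) \<bullet> (y - z) \<le> f y + e"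
      using sep[of y "f y + e"] s by (simp add: inner_diff_right field_simps)
  qed
  then show ?thesis unfolding subdifferential_def by blast
qed

text \<open>Only subgradients at \<open>z\<close> enter, while \<open>p\<close> is arbitrary. In the
  algorithm \<open>z\<close> is feasible, where subgradients are bounded, and \<open>p\<close> is a
  proximal point that may be infeasible.\<close>

lemma convex_diff_ge:
  fixes f :: "'a::euclidean_space \<Rightarrow> real"
  assumes "convex_on UNIV f" "\<forall>g\<in>subdifferential f z. norm g \<le> B"
  shows "f z - f p \<le> B * norm (p - z)"
proof -
  obtain g where g: "g \<in> subdifferential f z" using subgradient_exists[OF assms(1)] by blast
  have "f z - f p \<le> - (g \<bullet> (p - z))"
    using g by (auto simp: subdifferential_def) (smt (verit))
  also have "\<dots> \<le> norm g * norm (p - z)"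
    using Cauchy_Schwarz_ineq2[of g "p - z"] by linarith
  also have "\<dots> \<le> B * norm (p - z)"
    using assms(2) g by (intro mult_right_mono) auto
  finally show ?thesis .
qed

text \<open>First-order optimality without derivatives: compare \<open>p\<close> with
  \<open>p + t (y - p)\<close>, use convexity of \<open>g\<close>, divide by \<open>t\<close> and
  let \<open>t\<close> tend to zero.\<close>

lemma arg_min_prox_inner:
  fixes g :: "'a::real_inner \<Rightarrow> real"
  assumes g: "convex_on UNIV g"
    and p: "is_arg_min (\<lambda>y. g y + (norm (x - y))\<^sup>2 / 2) (\<lambda>_. True) p"
  shows "g p - g y \<le> (x - p) \<bullet> (p - y)"
proof (rule field_le_epsilon)
  fix e :: real assume "e > 0"
  \<comment> \<open>Small enough that the second-order term is at most \<open>e\<close>, and at most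
    1 so that the point stays on the segment from \<open>p\<close> to \<open>y\<close>.\<close>
  define t where "t = min 1 (e / ((norm (y - p))\<^sup>2 + 1))"
  have t: "0 < t" "t \<le> 1" using \<open>e > 0\<close> by (auto simp: t_def add_nonneg_pos)
  have te: "t * (norm (y - p))\<^sup>2 \<le> e"
  proof -
    have "t * (norm (y - p))\<^sup>2 \<le> e / ((norm (y - p))\<^sup>2 + 1) * (norm (y - p))\<^sup>2"
      by (intro mult_right_mono) (auto simp: t_def)
    also have "\<dots> \<le> e / ((norm (y - p))\<^sup>2 + 1) * ((norm (y - p))\<^sup>2 + 1)"
      using \<open>e > 0\<close> by (intro mult_left_mono) auto
    also have "\<dots> = e"
      using zero_le_power2[of "norm (y - p)"] by (simp add: add_nonneg_eq_0_iff)
    finally show ?thesis .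
  qed
  let ?q = "p + t *\<^sub>R (y - p)"
  have q: "?q = (1 - t) *\<^sub>R p + t *\<^sub>R y" by (simp add: algebra_simps)
  have 1: "g ?q \<le> (1 - t) * g p + t * g y"
    unfolding q using convex_onD[OF g, of t p y] t by auto
  have 2: "g p + (norm (x - p))\<^sup>2 / 2 \<le> g ?q + (norm (x - ?q))\<^sup>2 / 2"
    using p by (auto simp: is_arg_min_def not_less)
  have 3: "(norm (x - ?q))\<^sup>2 = (norm (x - p))\<^sup>2 + 2 * t * ((x - p) \<bullet> (p - y)) + t * t * (norm (y - p))\<^sup>2"
    unfolding power2_norm_eq_inner
    by (simp add: inner_diff_left inner_diff_right inner_add_left inner_add_right inner_commute algebra_simps)
  have "t * (g p - g y) \<le> t * ((x - p) \<bullet> (p - y)) + t * (t * (norm (y - p))\<^sup>2 / 2)"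
    using 1 2 3 by (simp add: algebra_simps)
  also have "\<dots> = t * ((x - p) \<bullet> (p - y) + t * (norm (y - p))\<^sup>2 / 2)"
    by (simp add: algebra_simps)
  finally have "g p - g y \<le> (x - p) \<bullet> (p - y) + t * (norm (y - p))\<^sup>2 / 2"
    using t(1) by simp
  then show "g p - g y \<le> (x - p) \<bullet> (p - y) + e"
    using te \<open>e > 0\<close> by linarith
qed

text \<open>Add the two variational inequalities, each tested at the other minimizer; the values of
  \<open>g\<close> cancel. The case \<open>x = x'\<close> gives uniqueness of the minimizer, the
  general case continuity of \<open>prox\<close>.\<close>

lemma arg_min_prox_nonexpansive:
  fixes g :: "'a::real_inner \<Rightarrow> real"
  assumes g: "convex_on UNIV g"
    and p: "is_arg_min (\<lambda>y. g y + (norm (x - y))\<^sup>2 / 2) (\<lambda>_. True) p"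
    and q: "is_arg_min (\<lambda>y. g y + (norm (x' - y))\<^sup>2 / 2) (\<lambda>_. True) q"
  shows "norm (p - q) \<le> norm (x - x')"
proof -
  have "0 \<le> (x - p) \<bullet> (p - q) + (x' - q) \<bullet> (q - p)"
    using arg_min_prox_inner[OF g p, of q] arg_min_prox_inner[OF g q, of p] by linarith
  then have "(norm (p - q))\<^sup>2 \<le> (x - x') \<bullet> (p - q)"
    unfolding power2_norm_eq_inner
    by (simp add: inner_diff_left inner_diff_right inner_commute algebra_simps)
  also have "\<dots> \<le> norm (x - x') * norm (p - q)" by (rule norm_cauchy_schwarz)
  finally show ?thesis by (cases "p = q") (simp_all add: power2_eq_square mult_le_cancel_right)
qed

text \<open>A subgradient \<open>s\<close> at \<open>x\<close> bounds \<open>g\<close> below by an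
  affine function. Outside the ball of radius \<open>2 * norm s\<close> the quadratic term outweighs
  its linear part, so a minimizer over this compact ball is a global one.\<close>

lemma arg_min_prox_exists:
  fixes g :: "'a::euclidean_space \<Rightarrow> real"
  assumes g: "convex_on UNIV g"
  shows "\<exists>p. is_arg_min (\<lambda>y. g y + (norm (x - y))\<^sup>2 / 2) (\<lambda>_. True) p"
proof -
  let ?h = "\<lambda>y. g y + (norm (x - y))\<^sup>2 / 2"
  obtain s where s: "s \<in> subdifferential g x" using subgradient_exists[OF g] by blast
  define R where "R = 2 * norm s"
  have "continuous_on (cball x R) ?h"
    using continuous_on_subset[OF convex_on_continuous[OF open_UNIV g] subset_UNIV]
    by (intro continuous_intros) auto
  then obtain p where p: "p \<in> cball x R" "\<forall>y\<in>cball x R. ?h p \<le> ?h y"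
    using continuous_attains_inf[of "cball x R" ?h] by (auto simp: R_def)
  have "?h p \<le> ?h y" for y
  proof (cases "y \<in> cball x R")
    case False
    then have "norm (y - x) > 2 * norm s" by (simp add: R_def dist_norm norm_minus_commute)
    then have "0 \<le> norm (y - x) * (norm (y - x) / 2 - norm s)" by (intro mult_nonneg_nonneg) auto
    also have "\<dots> \<le> (norm (x - y))\<^sup>2 / 2 + s \<bullet> (y - x)"
      using Cauchy_Schwarz_ineq2[of s "y - x"]
      by (simp add: algebra_simps power2_eq_square norm_minus_commute abs_le_iff)
    finally have "g x \<le> ?h y" using s by (auto simp: subdifferential_def) (smt (verit))
    moreover have "?h p \<le> ?h x" using p(2) by (rule bspec) (simp add: R_def)
    ultimately show ?thesis by simp
  qed (use p in auto)
  then show ?thesis by (auto simp: is_arg_min_def not_less)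
qed

lemma prox_is_arg_min:
  fixes g :: "'a::euclidean_space \<Rightarrow> real"
  assumes g: "convex_on UNIV g"
  shows "is_arg_min (\<lambda>y. g y + (norm (x - y))\<^sup>2 / 2) (\<lambda>_. True) (prox g x)"
  unfolding prox_def
proof (rule theI')
  show "\<exists>!p. is_arg_min (\<lambda>y. g y + (norm (x - y))\<^sup>2 / 2) (\<lambda>_. True) p"
    using arg_min_prox_exists[OF g] arg_min_prox_nonexpansive[OF g, of x _ x] by fastforce
qed

text \<open>Polarization rewrites the inner product of the variational inequality in terms of three
  squared distances.\<close>

lemma prox_le:
  fixes g :: "'a::euclidean_space \<Rightarrow> real"
  assumes "convex_on UNIV g"
  shows "(norm (prox g x - y))\<^sup>2 + (norm (x - prox g x))\<^sup>2 + 2 * (g (prox g x) - g y) \<le> (norm (x - y))\<^sup>2"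
  using arg_min_prox_inner[OF assms prox_is_arg_min[OF assms], of x y]
  unfolding power2_norm_eq_inner
  by (simp add: inner_diff_left inner_diff_right inner_commute algebra_simps)

lemma continuous_on_prox:
  fixes g :: "'a::euclidean_space \<Rightarrow> real"
  assumes g: "convex_on UNIV g"
  shows "continuous_on S (prox g)"
proof -
  have "1-lipschitz_on S (prox g)"
    using arg_min_prox_nonexpansive[OF g prox_is_arg_min[OF g] prox_is_arg_min[OF g]]
    by (intro lipschitz_onI) (auto simp: dist_norm)
  then show ?thesis by (rule lipschitz_on_continuous_on)
qed

section \<open>Metric projections and the combined proximal-projection step\<close>

lemma infdist_closest_point:
  fixes S :: "'a::euclidean_space set"
  assumes "closed S" "S \<noteq> {}"
  shows "infdist y S = norm (y - closest_point S y)"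
  using infdist_notempty[OF assms(2), of y] closest_point_exists[OF assms, of y]
  by (auto simp: dist_norm intro!: antisym cINF_lower cINF_greatest bdd_belowI2[of _ 0])

text \<open>The segments from the projection to \<open>p\<close> and to \<open>y\<close> meet at an
  angle that is not acute, so the Pythagorean identity becomes an inequality.\<close>

lemma closest_point_le_sq:
  fixes C :: "'a::euclidean_space set"
  assumes "closed C" "convex C" "y \<in> C"
  shows "(norm (closest_point C p - y))\<^sup>2 + (infdist p C)\<^sup>2 \<le> (norm (p - y))\<^sup>2"
proof -
  have "C \<noteq> {}" using assms by auto
  show ?thesis
    using closest_point_dot[OF assms(2,1,3), of p]
    unfolding infdist_closest_point[OF assms(1) \<open>C \<noteq> {}\<close>] power2_norm_eq_inner
    by (simp add: inner_diff_left inner_diff_right inner_commute algebra_simps)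
qed

text \<open>Young's inequality with a free weight \<open>t\<close>.\<close>

lemma power2_add_le:
  fixes a b :: real
  assumes "0 < t"
  shows "(a + b)\<^sup>2 \<le> (1 + t) * a\<^sup>2 + (1 + 1 / t) * b\<^sup>2"
proof -
  have "0 \<le> (t * a - b)\<^sup>2 / t" using assms by simp
  also have "\<dots> = t * a\<^sup>2 + b\<^sup>2 / t - 2 * a * b"
    using assms by (simp add: power2_eq_square field_simps)
  finally show ?thesis by (simp add: power2_eq_square algebra_simps)
qed

text \<open>The proximal step gains the full square of \<open>norm (u - p)\<close>, the projection
  gains the squared distance of \<open>p\<close> to \<open>C\<close>. Half of the former is spent on
  moving the latter from \<open>p\<close> to \<open>u\<close>, the point to which
  \<open>regularity\<close> will be applied.\<close>

lemma proximal_projection_step: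
  fixes f :: "'a::euclidean_space \<Rightarrow> real" and u :: 'a
  assumes "convex_on UNIV f" "a > 0" "closed C" "convex C" "y \<in> C"
  defines "p \<equiv> prox (\<lambda>y. a * f y) u"
  shows "(norm (closest_point C p - y))\<^sup>2 + (norm (u - p))\<^sup>2 / 2 + (infdist u C)\<^sup>2 / 4
    \<le> (norm (u - y))\<^sup>2 + 2 * a * (f y - f p)"
proof -
  have cvx: "convex_on UNIV (\<lambda>y. a * f y)"
    using assms(1,2) by (intro convex_on_cmul) auto
  have "(infdist u C)\<^sup>2 \<le> (infdist p C + norm (u - p))\<^sup>2"
    using infdist_triangle[of u C p] infdist_nonneg[of u C] by (simp add: dist_norm power_mono)
  also have "\<dots> \<le> 2 * (infdist p C)\<^sup>2 + 2 * (norm (u - p))\<^sup>2"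
    using power2_add_le[of 1 "infdist p C" "norm (u - p)"] by simp
  finally have "(infdist u C)\<^sup>2 / 4 \<le> (infdist p C)\<^sup>2 / 2 + (norm (u - p))\<^sup>2 / 2" by simp
  moreover have "2 * (a * f p - a * f y) = - (2 * a * (f y - f p))"
    by (simp add: algebra_simps)
  ultimately show ?thesis
    using prox_le[OF cvx, of u y, folded p_def] closest_point_le_sq[OF assms(3-5), of p]
      zero_le_power2[of "infdist p C"]
    by linarith
qed

section \<open>Averaging with doubly stochastic weights\<close>

text \<open>The parallel axis identity: both sides come from expanding the second moment about a
  point, once about \<open>y\<close> and once about the mean \<open>c\<close>.\<close>

lemma weighted_variance:
  fixes u :: "'i \<Rightarrow> 'a::real_inner" and a :: "'i \<Rightarrow> real"
  assumes "sum a S = 1"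
  defines "c \<equiv> \<Sum>j\<in>S. a j *\<^sub>R u j"
  shows "(\<Sum>j\<in>S. a j * (norm (u j - y))\<^sup>2) = (norm (c - y))\<^sup>2 + (\<Sum>j\<in>S. a j * (norm (u j - c))\<^sup>2)"
proof -
  have expand: "(\<Sum>j\<in>S. a j * (norm (u j - z))\<^sup>2) = (\<Sum>j\<in>S. a j * (u j \<bullet> u j)) - 2 * (c \<bullet> z) + z \<bullet> z" for z
  proof -
    have "a j * (norm (u j - z))\<^sup>2 = a j * (u j \<bullet> u j) - 2 * ((a j *\<^sub>R u j) \<bullet> z) + a j * (z \<bullet> z)" for j
      unfolding power2_norm_eq_inner
      by (simp add: inner_diff_left inner_diff_right inner_commute algebra_simps)
    then have "(\<Sum>j\<in>S. a j * (norm (u j - z))\<^sup>2)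
        = (\<Sum>j\<in>S. a j * (u j \<bullet> u j)) - 2 * ((\<Sum>j\<in>S. a j *\<^sub>R u j) \<bullet> z) + (\<Sum>j\<in>S. a j) * (z \<bullet> z)"
      by (simp add: sum.distrib sum_subtractf sum_distrib_left sum_distrib_right inner_sum_left)
    then show ?thesis using assms by simp
  qed
  have "(norm (c - y))\<^sup>2 = c \<bullet> c - 2 * (c \<bullet> y) + y \<bullet> y"
    unfolding power2_norm_eq_inner by (simp add: inner_diff_left inner_diff_right inner_commute)
  then show ?thesis unfolding expand by simp
qed

lemma weighted_norm_sq_le:
  fixes u :: "'i \<Rightarrow> 'a::real_inner" and a :: "'i \<Rightarrow> real"
  assumes "sum a S = 1" "\<And>j. j \<in> S \<Longrightarrow> 0 \<le> a j"
  shows "(norm ((\<Sum>j\<in>S. a j *\<^sub>R u j) - y))\<^sup>2 \<le> (\<Sum>j\<in>S. a j * (norm (u j - y))\<^sup>2)"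
  using weighted_variance[OF assms(1), of u y] assms(2) by (simp add: sum_nonneg)

text \<open>The combination of the projections lies in \<open>X\<close>, so it bounds the distance
  from above; convexity of the squared norm does the rest.\<close>

lemma infdist_sq_weighted_le:
  fixes u :: "'i \<Rightarrow> 'a::euclidean_space" and a :: "'i \<Rightarrow> real"
  assumes "finite S" "sum a S = 1" "\<And>j. j \<in> S \<Longrightarrow> 0 \<le> a j" "closed X" "convex X" "X \<noteq> {}"
  shows "(infdist (\<Sum>j\<in>S. a j *\<^sub>R u j) X)\<^sup>2 \<le> (\<Sum>j\<in>S. a j * (infdist (u j) X)\<^sup>2)"
proof -
  let ?z = "\<lambda>j. closest_point X (u j)"
  have "(\<Sum>j\<in>S. a j *\<^sub>R ?z j) \<in> X"
    using assms by (intro convex_sum closest_point_in_set) auto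
  then have "infdist (\<Sum>j\<in>S. a j *\<^sub>R u j) X \<le> norm ((\<Sum>j\<in>S. a j *\<^sub>R u j) - (\<Sum>j\<in>S. a j *\<^sub>R ?z j))"
    by (metis infdist_le dist_norm)
  then have "(infdist (\<Sum>j\<in>S. a j *\<^sub>R u j) X)\<^sup>2 \<le> (norm ((\<Sum>j\<in>S. a j *\<^sub>R (u j - ?z j)) - 0))\<^sup>2"
    by (simp add: power_mono infdist_nonneg scaleR_diff_right sum_subtractf)
  also have "\<dots> \<le> (\<Sum>j\<in>S. a j * (norm (u j - ?z j - 0))\<^sup>2)"
    using assms by (intro weighted_norm_sq_le) auto
  finally show ?thesis using assms by (simp add: infdist_closest_point)
qed

section \<open>Variance of the users' points, up to the factor \<open>m\<close>\<close>

definition spread :: "nat \<Rightarrow> (nat \<Rightarrow> 'a::real_inner) \<Rightarrow> real" where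
  "spread m u = (\<Sum>i=1..m. (norm (u i - average m u))\<^sup>2)"

lemma spread_nonneg: "0 \<le> spread m u"
  by (simp add: spread_def sum_nonneg)

lemma spread_cong:
  assumes "\<And>i. i \<in> {1..m} \<Longrightarrow> u i = u' i"
  shows "spread m u = spread m u'"
  using assms by (simp add: spread_def average_def)

lemma sum_norm_sq_average:
  assumes "m \<ge> 1"
  shows "(\<Sum>i=1..m. (norm (u i - y))\<^sup>2) = real m * (norm (average m u - y))\<^sup>2 + spread m u"
proof -
  have avg: "(\<Sum>i=1..m. (1 / real m) *\<^sub>R u i) = average m u"
    by (simp add: average_def scaleR_right.sum)
  have "(\<Sum>i=1..m. 1 / real m * (norm (u i - y))\<^sup>2)
      = (norm (average m u - y))\<^sup>2 + (\<Sum>i=1..m. 1 / real m * (norm (u i - average m u))\<^sup>2)"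
    using assms unfolding avg[symmetric] by (intro weighted_variance) simp
  then have "(1 / real m) * (\<Sum>i=1..m. (norm (u i - y))\<^sup>2)
      = (norm (average m u - y))\<^sup>2 + (1 / real m) * spread m u"
    by (simp add: spread_def sum_distrib_left)
  then show ?thesis using assms by (simp add: divide_simps)
qed

lemma spread_le:
  assumes "m \<ge> 1"
  shows "spread m u \<le> (\<Sum>i=1..m. (norm (u i - y))\<^sup>2)"
  using sum_norm_sq_average[OF assms, of u y] by simp

text \<open>The average minimizes the sum of squared distances, so the spread of \<open>u'\<close>
  may be measured about the average of \<open>u\<close>; then Young's inequality applies to each
  user.\<close>

lemma spread_perturb:
  fixes u u' :: "nat \<Rightarrow> 'a::real_inner"
  assumes "m \<ge> 1" "0 < t"
  shows "spread m u' \<le> (1 + t) * spread m u + (1 + 1 / t) * (\<Sum>i=1..m. (norm (u' i - u i))\<^sup>2)"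
proof -
  have "(norm (u' i - average m u))\<^sup>2 \<le> (1 + t) * (norm (u i - average m u))\<^sup>2
      + (1 + 1 / t) * (norm (u' i - u i))\<^sup>2" for i
  proof -
    have "norm (u' i - average m u) \<le> norm (u i - average m u) + norm (u' i - u i)"
      using norm_triangle_ineq[of "u i - average m u" "u' i - u i"] by simp
    then have "(norm (u' i - average m u))\<^sup>2 \<le> (norm (u i - average m u) + norm (u' i - u i))\<^sup>2"
      by (simp add: power_mono)
    also note power2_add_le[OF assms(2)]
    finally show ?thesis .
  qed
  then have "(\<Sum>i=1..m. (norm (u' i - average m u))\<^sup>2)
      \<le> (\<Sum>i=1..m. (1 + t) * (norm (u i - average m u))\<^sup>2 + (1 + 1 / t) * (norm (u' i - u i))\<^sup>2)"
    by (rule sum_mono)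
  then show ?thesis
    using spread_le[OF assms(1), of u' "average m u"]
    by (simp add: spread_def sum.distrib sum_distrib_left)
qed

text \<open>The deviation of \<open>z i\<close> from its average is the mean of the differences
  \<open>z i - z l\<close>. Each is at most the deviation of \<open>u i\<close> plus that of
  \<open>u l\<close>, and summing counts every deviation twice.\<close>

lemma sum_norm_average_le:
  fixes u z :: "nat \<Rightarrow> 'a::real_inner"
  assumes m: "m \<ge> 1"
    and z: "\<And>i l. norm (z i - z l) \<le> norm (u i - u l)"
  shows "(\<Sum>i=1..m. norm (z i - average m z)) \<le> 2 * (\<Sum>i=1..m. norm (u i - average m u))"
proof -
  let ?S = "\<Sum>i=1..m. norm (u i - average m u)"
  have "norm (z i - average m z) \<le> norm (u i - average m u) + ?S / real m" for i
  proof -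
    have "z i - average m z = (1 / real m) *\<^sub>R (\<Sum>l=1..m. z i - z l)"
      using m by (simp add: average_def sum_subtractf scaleR_diff_right sum_constant_scaleR)
    then have "norm (z i - average m z) = norm (\<Sum>l=1..m. z i - z l) / real m"
      using m by simp
    also have "\<dots> \<le> (\<Sum>l=1..m. norm (u i - average m u) + norm (u l - average m u)) / real m"
    proof (intro divide_right_mono order.trans[OF norm_sum] sum_mono)
      fix l
      show "norm (z i - z l) \<le> norm (u i - average m u) + norm (u l - average m u)"
        using z[of i l] norm_triangle_ineq4[of "u i - average m u" "u l - average m u"] by simp
    qed simp
    also have "\<dots> = norm (u i - average m u) + ?S / real m"
      using m by (simp add: sum.distrib field_simps)
    finally show ?thesis .
  qed
  then have "(\<Sum>i=1..m. norm (z i - average m z)) \<le> (\<Sum>i=1..m. norm (u i - average m u) + ?S / real m)"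
    by (rule sum_mono)
  also have "\<dots> = 2 * ?S" using m by (simp add: sum.distrib)
  finally show ?thesis .
qed

section \<open>Connectivity of the graph and contraction of the variance\<close>

lemma relpow_norm_diff_le:
  assumes "(a, b) \<in> R ^^ n" "\<And>i j. (i, j) \<in> R \<Longrightarrow> norm (u i - u j) \<le> d"
  shows "norm (u a - u b :: 'a::real_normed_vector) \<le> real n * d"
  using assms(1)
proof (induction n arbitrary: b)
  case (Suc n)
  then obtain c where c: "(a, c) \<in> R ^^ n" "(c, b) \<in> R" by auto
  have "norm (u a - u b) \<le> norm (u a - u c) + norm (u c - u b)"
    using norm_triangle_ineq[of "u a - u c" "u c - u b"] by simp
  then show ?case using Suc.IH[OF c(1)] assms(2)[OF c(2)] by (simp add: algebra_simps)
qed simp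

lemma arcs_ends_user_graph: "arcs_ends (user_graph m A) = A"
  by (simp add: arcs_ends_def arc_to_ends_def user_graph_def)

text \<open>It passes from the intersection of the graphs over a time window to the single graph at
  each time.\<close>

lemma strongly_connected_user_graph_mono:
  assumes "strongly_connected (user_graph m A)" "A \<subseteq> A'"
  shows "strongly_connected (user_graph m A')"
  using assms(1) rtrancl_on_mono[OF assms(2) order_refl[of "{1..m}"]]
  unfolding strongly_connected_def reachable_def arcs_ends_user_graph
  by (simp add: user_graph_def)

text \<open>Some path joins \<open>a\<close> and \<open>b\<close> with at most \<open>card A\<close>
  arcs, which is crudely at most the square of \<open>m\<close>; the differences along it add
  up.\<close>

lemma strongly_connected_norm_diff_le:
  fixes u :: "nat \<Rightarrow> 'a::real_normed_vector"
  assumes con: "strongly_connected (user_graph m A)" and A: "A \<subseteq> {1..m} \<times> {1..m}"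
    and d: "\<And>i j. (i, j) \<in> A \<Longrightarrow> norm (u i - u j) \<le> d" "0 \<le> d"
    and ab: "a \<in> {1..m}" "b \<in> {1..m}"
  shows "norm (u a - u b) \<le> real (m\<^sup>2) * d"
proof -
  have fin: "finite A" using A finite_subset by blast
  have "(a, b) \<in> rtrancl_on {1..m} A"
    using con ab unfolding strongly_connected_def reachable_def arcs_ends_user_graph
    by (simp add: user_graph_def)
  then have "(a, b) \<in> A\<^sup>*"
    by (induction rule: rtrancl_on_induct) auto
  then obtain k where "(a, b) \<in> A ^^ k" using rtrancl_power by blast
  then obtain n where n: "n \<le> card A" "(a, b) \<in> A ^^ n"
    using relpow_finite_bounded[OF fin, of k] by auto
  have "card A \<le> m\<^sup>2"
    using card_mono[OF _ A] by (simp add: power2_eq_square)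
  then have "real n * d \<le> real (m\<^sup>2) * d"
    using n(1) d(2) by (intro mult_right_mono) auto
  then show ?thesis using relpow_norm_diff_le[OF n(2), of u d] d(1) by force
qed

text \<open>Averaging lowers the spread by at least \<open>D\<close>, the total variance within the
  rows of \<open>W\<close>. If \<open>D\<close> is small, the points joined by an arc are close,
  hence by connectivity all points are, so the spread itself is bounded by a multiple of
  \<open>D\<close>.\<close>

lemma spread_doubly_stochastic_le:
  fixes u :: "nat \<Rightarrow> 'a::real_inner" and W :: "nat \<Rightarrow> nat \<Rightarrow> real"
  assumes m: "m \<ge> 1" and w0: "0 < w0"
    and W: "\<And>i j. i \<in> {1..m} \<Longrightarrow> j \<in> {1..m} \<Longrightarrow> 0 \<le> W i j"
    and rows: "\<And>i. i \<in> {1..m} \<Longrightarrow> (\<Sum>j=1..m. W i j) = 1"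
    and cols: "\<And>j. j \<in> {1..m} \<Longrightarrow> (\<Sum>i=1..m. W i j) = 1"
    and A: "strongly_connected (user_graph m A)" "A \<subseteq> {1..m} \<times> {1..m}"
    and lower: "\<And>i j. (i, j) \<in> A \<Longrightarrow> w0 \<le> W i j" "\<And>i. i \<in> {1..m} \<Longrightarrow> w0 \<le> W i i"
  shows "spread m (\<lambda>i. \<Sum>j=1..m. W i j *\<^sub>R u j) \<le> (1 - w0 / (2 * real m ^ 5)) * spread m u"
proof -
  define v where "v = (\<lambda>i. \<Sum>j=1..m. W i j *\<^sub>R u j)"
  define D where "D = (\<Sum>i=1..m. \<Sum>l=1..m. W i l * (norm (u l - v i))\<^sup>2)"
  have D_nonneg: "0 \<le> D" unfolding D_def using W by (intro sum_nonneg mult_nonneg_nonneg) auto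
  have "spread m v \<le> (\<Sum>i=1..m. (norm (v i - average m u))\<^sup>2)" by (rule spread_le[OF m])
  also have "\<dots> = (\<Sum>i=1..m. (\<Sum>j=1..m. W i j * (norm (u j - average m u))\<^sup>2)
      - (\<Sum>l=1..m. W i l * (norm (u l - v i))\<^sup>2))"
  proof (rule sum.cong)
    fix i assume "i \<in> {1..m}"
    from weighted_variance[OF rows[OF this], of u "average m u"]
    show "(norm (v i - average m u))\<^sup>2 = (\<Sum>j=1..m. W i j * (norm (u j - average m u))\<^sup>2)
      - (\<Sum>l=1..m. W i l * (norm (u l - v i))\<^sup>2)" by (simp add: v_def)
  qed simp
  also have "\<dots> = (\<Sum>j=1..m. (\<Sum>i=1..m. W i j) * (norm (u j - average m u))\<^sup>2) - D"
    unfolding D_def sum_subtractf by (subst sum.swap) (simp add: sum_distrib_right)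
  also have "\<dots> = spread m u - D"
    using cols by (simp add: spread_def)
  finally have drop: "spread m v \<le> spread m u - D" .
  \<comment> \<open>Both \<open>u i\<close> and \<open>u j\<close> carry weight at least
    \<open>w0\<close> in the row average \<open>v i\<close>, so their distances to
    \<open>v i\<close> are controlled by \<open>D\<close>. Loops are treated apart because for
    \<open>i = j\<close> the two terms of the sum over \<open>{i, j}\<close> would merge.\<close>
  have edge: "norm (u i - u j) \<le> sqrt (2 * D / w0)" if ij: "(i, j) \<in> A" for i j
  proof (cases "i = j")
    case False
    have mem: "i \<in> {1..m}" "j \<in> {1..m}" using ij A(2) by auto
    have "norm (u i - u j) \<le> norm (u i - v i) + norm (u j - v i)"
      using norm_triangle_ineq4[of "u i - v i" "u j - v i"] by simp
    then have "(norm (u i - u j))\<^sup>2 \<le> (norm (u i - v i) + norm (u j - v i))\<^sup>2"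
      by (simp add: power_mono)
    also have "\<dots> \<le> 2 * (norm (u i - v i))\<^sup>2 + 2 * (norm (u j - v i))\<^sup>2"
      using power2_add_le[of 1 "norm (u i - v i)" "norm (u j - v i)"] by simp
    finally have "w0 * (norm (u i - u j))\<^sup>2
        \<le> w0 * (2 * (norm (u i - v i))\<^sup>2 + 2 * (norm (u j - v i))\<^sup>2)"
      using w0 by (intro mult_left_mono) auto
    also have "\<dots> = 2 * (w0 * (norm (u i - v i))\<^sup>2 + w0 * (norm (u j - v i))\<^sup>2)"
      by (simp add: algebra_simps)
    also have "\<dots> \<le> 2 * (W i i * (norm (u i - v i))\<^sup>2 + W i j * (norm (u j - v i))\<^sup>2)"
      using lower(1)[OF ij] lower(2)[OF mem(1)]
      by (intro mult_left_mono add_mono mult_right_mono) auto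
    also have "\<dots> = 2 * (\<Sum>l\<in>{i, j}. W i l * (norm (u l - v i))\<^sup>2)"
      using False by simp
    also have "\<dots> \<le> 2 * (\<Sum>l=1..m. W i l * (norm (u l - v i))\<^sup>2)"
      using mem W by (intro mult_left_mono sum_mono2) auto
    also have "\<dots> \<le> 2 * D"
      unfolding D_def using mem W
      by (intro mult_left_mono member_le_sum[of i _ "\<lambda>i. \<Sum>l=1..m. W i l * (norm (u l - v i))\<^sup>2"] sum_nonneg) auto
    finally have "(norm (u i - u j))\<^sup>2 \<le> 2 * D / w0" using w0 by (simp add: field_simps)
    then show ?thesis by (rule real_le_rsqrt)
  qed (use D_nonneg w0 in simp)
  have pair: "(norm (u a - u b))\<^sup>2 \<le> real m ^ 4 * (2 * D / w0)" if "a \<in> {1..m}" "b \<in> {1..m}" for a b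
  proof -
    have "norm (u a - u b) \<le> real (m\<^sup>2) * sqrt (2 * D / w0)"
      using strongly_connected_norm_diff_le[OF A edge _ that] D_nonneg w0 by simp
    then have "(norm (u a - u b))\<^sup>2 \<le> (real (m\<^sup>2) * sqrt (2 * D / w0))\<^sup>2"
      by (simp add: power_mono)
    then show ?thesis using D_nonneg w0 by (simp add: power_mult_distrib)
  qed
  have "spread m u \<le> (\<Sum>i=1..m. (norm (u i - u 1))\<^sup>2)" by (rule spread_le[OF m])
  also have "\<dots> \<le> (\<Sum>i=1..m. real m ^ 4 * (2 * D / w0))"
    using m by (intro sum_mono pair) auto
  \<comment> \<open>Four of the five powers of \<open>m\<close> come from squaring the path length
    bound, one from the number of users.\<close>
  also have "\<dots> = real m * real m ^ 4 * (2 * D / w0)" by simp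
  also have "\<dots> = 2 * real m ^ 5 / w0 * D" unfolding power_Suc[symmetric] by simp
  finally have "w0 / (2 * real m ^ 5) * spread m u \<le> D"
    using m w0 by (simp add: field_simps)
  then show ?thesis using drop by (simp add: v_def algebra_simps)
qed

text \<open>Young's inequality for the perturbation from \<open>u\<close> to \<open>u'\<close> is
  used with the contraction rate \<open>t\<close> itself as weight, so that the factor
  \<open>(1 - t) * (1 + t)\<close> remains below 1.\<close>

lemma spread_averaging_step:
  fixes u u' :: "nat \<Rightarrow> 'a::real_inner" and W :: "nat \<Rightarrow> nat \<Rightarrow> real"
  assumes m: "m \<ge> 1" and w0: "0 < w0" "w0 < 1"
    and W: "\<And>i j. i \<in> {1..m} \<Longrightarrow> j \<in> {1..m} \<Longrightarrow> 0 \<le> W i j"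
    and rows: "\<And>i. i \<in> {1..m} \<Longrightarrow> (\<Sum>j=1..m. W i j) = 1"
    and cols: "\<And>j. j \<in> {1..m} \<Longrightarrow> (\<Sum>i=1..m. W i j) = 1"
    and A: "strongly_connected (user_graph m A)" "A \<subseteq> {1..m} \<times> {1..m}"
    and lower: "\<And>i j. (i, j) \<in> A \<Longrightarrow> w0 \<le> W i j" "\<And>i. i \<in> {1..m} \<Longrightarrow> w0 \<le> W i i"
  defines "t \<equiv> w0 / (2 * real m ^ 5)"
  shows "spread m (\<lambda>i. \<Sum>j=1..m. W i j *\<^sub>R u' j) + t\<^sup>2 * spread m u
    \<le> spread m u + (1 / t) * (\<Sum>i=1..m. (norm (u' i - u i))\<^sup>2)"
proof -
  let ?e = "\<Sum>i=1..m. (norm (u' i - u i))\<^sup>2"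
  have e: "0 \<le> ?e" by (simp add: sum_nonneg)
  have "1 \<le> real m ^ 5" using m by (simp add: one_le_power)
  then have "w0 < 2 * real m ^ 5" using w0 by linarith
  then have t: "0 < t" "t < 1" using w0 m by (auto simp: t_def)
  have "spread m (\<lambda>i. \<Sum>j=1..m. W i j *\<^sub>R u' j) \<le> (1 - t) * spread m u'"
    unfolding t_def by (rule spread_doubly_stochastic_le[OF m w0(1) W rows cols A lower])
  also have "\<dots> \<le> (1 - t) * ((1 + t) * spread m u + (1 + 1 / t) * ?e)"
    using t by (intro mult_left_mono spread_perturb[OF m]) auto
  \<comment> \<open>Here \<open>(1 - t) * (1 + 1 / t) = 1 / t - t\<close>; the negative part is
    dropped afterwards.\<close>
  also have "\<dots> = (1 - t\<^sup>2) * spread m u + (1 / t) * ?e - t * ?e"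
    using t(1) by (simp add: field_simps power2_eq_square)
  finally show ?thesis using mult_nonneg_nonneg[OF less_imp_le[OF t(1)] e] by (simp add: algebra_simps)
qed

section \<open>Conditional expectations and almost sure summability\<close>

text \<open>Telescoping in additive form, which stays meaningful for extended values where
  subtraction does not.\<close>

lemma ennreal_series_bound:
  fixes Y b c :: "nat \<Rightarrow> ennreal"
  assumes "\<And>k. Y (Suc k) + b k \<le> Y k + c k" "Y 0 < \<infinity>" "(\<Sum>k. c k) < \<infinity>"
  shows "(\<Sum>k. b k) < \<infinity>"
proof -
  have "Y n + (\<Sum>k<n. b k) \<le> Y 0 + (\<Sum>k<n. c k)" for n
  proof (induction n)
    case (Suc n)
    have "Y (Suc n) + (\<Sum>k<Suc n. b k) = (Y (Suc n) + b n) + (\<Sum>k<n. b k)"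
      by (simp add: ac_simps)
    also have "\<dots> \<le> (Y n + c n) + (\<Sum>k<n. b k)"
      by (intro add_mono assms(1)) simp
    also have "\<dots> = (Y n + (\<Sum>k<n. b k)) + c n" by (simp add: ac_simps)
    also have "\<dots> \<le> Y 0 + (\<Sum>k<Suc n. c k)"
      using add_mono[OF Suc.IH order_refl[of "c n"]] by (simp add: ac_simps)
    finally show ?case .
  qed simp
  then have "(\<Sum>k<n. b k) \<le> Y 0 + (\<Sum>k. c k)" for n
    by (meson add_increasing add_mono order_refl order_trans sum_le_suminf summableI
        finite_lessThan zero_le)
  then have "(\<Sum>k. b k) \<le> Y 0 + (\<Sum>k. c k)"
    unfolding suminf_eq_SUP by (rule SUP_least)
  also have "\<dots> < \<infinity>" using assms by (simp add: less_top)
  finally show ?thesis .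
qed

text \<open>By monotone convergence the series is integrable over each \<open>A N\<close>, hence
  almost surely finite there. Countably many null sets are discarded, and every sample point lies in
  some \<open>A N\<close>.\<close>

lemma AE_summable_if_restricted_integrals:
  fixes h :: "nat \<Rightarrow> 'w \<Rightarrow> real"
  assumes h: "\<And>k. h k \<in> borel_measurable M" "\<And>k \<omega>. \<omega> \<in> space M \<Longrightarrow> 0 \<le> h k \<omega>"
    and A: "\<And>N::nat. A N \<in> sets M" "space M \<subseteq> (\<Union>N. A N)"
    and fin: "\<And>N. (\<Sum>k. \<integral>\<^sup>+\<omega>\<in>A N. ennreal (h k \<omega>) \<partial>M) < \<infinity>"
  shows "AE \<omega> in M. summable (\<lambda>k. h k \<omega>)"
proof -
  have "AE \<omega> in M. (\<Sum>k. ennreal (h k \<omega>) * indicator (A N) \<omega>) \<noteq> \<infinity>" for N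
  proof (rule nn_integral_PInf_AE)
    have "(\<integral>\<^sup>+\<omega>. (\<Sum>k. ennreal (h k \<omega>) * indicator (A N) \<omega>) \<partial>M)
        = (\<Sum>k. \<integral>\<^sup>+\<omega>\<in>A N. ennreal (h k \<omega>) \<partial>M)"
      using h(1) A(1) by (intro nn_integral_suminf) auto
    then show "(\<integral>\<^sup>+\<omega>. (\<Sum>k. ennreal (h k \<omega>) * indicator (A N) \<omega>) \<partial>M) \<noteq> \<infinity>"
      using fin[of N] by simp
  qed (use h(1) A(1) in measurable)
  then have "AE \<omega> in M. \<forall>N. (\<Sum>k. ennreal (h k \<omega>) * indicator (A N) \<omega>) \<noteq> \<infinity>"
    by (simp add: AE_all_countable)
  then show ?thesis
    using AE_space
  proof eventually_elim
    case (elim \<omega>)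
    then obtain N where "\<omega> \<in> A N" using A(2) by auto
    then have "(\<Sum>k. ennreal (h k \<omega>)) \<noteq> \<infinity>" using elim(1) by (auto dest!: spec[of _ N])
    then show ?case using h(2)[OF elim(2)] by (auto intro: summable_suminf_not_top)
  qed
qed

text \<open>Integrating over an event of \<open>F\<close> removes the conditional expectation, by
  its defining property.\<close>

lemma (in sigma_finite_subalgebra) nn_cond_exp_set_integral_le:
  assumes A: "A \<in> sets F"
    and meas: "Y \<in> borel_measurable M" "b \<in> borel_measurable M" "c \<in> borel_measurable M"
    and le: "AE \<omega> in M. nn_cond_exp M F Y \<omega> + b \<omega> \<le> c \<omega>"
  shows "(\<integral>\<^sup>+\<omega>\<in>A. Y \<omega> \<partial>M) + (\<integral>\<^sup>+\<omega>\<in>A. b \<omega> \<partial>M) \<le> (\<integral>\<^sup>+\<omega>\<in>A. c \<omega> \<partial>M)"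
proof -
  have [measurable]: "A \<in> sets M" using A subalg by (auto simp: subalgebra_def)
  note meas[measurable]
  have "(\<integral>\<^sup>+\<omega>\<in>A. Y \<omega> \<partial>M) = (\<integral>\<^sup>+\<omega>. indicator A \<omega> * nn_cond_exp M F Y \<omega> \<partial>M)"
    using A by (subst nn_cond_exp_intg) (auto simp: mult.commute)
  then have "(\<integral>\<^sup>+\<omega>\<in>A. Y \<omega> \<partial>M) + (\<integral>\<^sup>+\<omega>\<in>A. b \<omega> \<partial>M)
      = (\<integral>\<^sup>+\<omega>. indicator A \<omega> * nn_cond_exp M F Y \<omega> + b \<omega> * indicator A \<omega> \<partial>M)"
    by (subst nn_integral_add) (auto intro!: borel_measurable_times_ennreal
        measurable_from_subalg[OF subalg borel_measurable_nn_cond_exp])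
  also have "\<dots> \<le> (\<integral>\<^sup>+\<omega>\<in>A. c \<omega> \<partial>M)"
    using le by (intro nn_integral_mono_AE) (auto split: split_indicator)
  finally show ?thesis .
qed

lemma (in sigma_finite_subalgebra) nn_cond_exp_finite_sum:
  assumes "finite J" "\<And>j. j \<in> J \<Longrightarrow> g j \<in> borel_measurable M"
  shows "AE \<omega> in M. nn_cond_exp M F (\<lambda>\<omega>. \<Sum>j\<in>J. g j \<omega>) \<omega> = (\<Sum>j\<in>J. nn_cond_exp M F (g j) \<omega>)"
  using assms
proof (induction J rule: finite_induct)
  case empty
  have "AE \<omega> in M. (\<lambda>_. 0 :: ennreal) \<omega> = nn_cond_exp M F (\<lambda>_. 0) \<omega>"
    by (rule nn_cond_exp_F_meas) simp
  then show ?case by eventually_elim simp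
next
  case (insert j J)
  then have "AE \<omega> in M. nn_cond_exp M F (\<lambda>\<omega>. \<Sum>j\<in>J. g j \<omega>) \<omega> = (\<Sum>j\<in>J. nn_cond_exp M F (g j) \<omega>)"
    by auto
  moreover have "AE \<omega> in M. nn_cond_exp M F (g j) \<omega> + nn_cond_exp M F (\<lambda>\<omega>. \<Sum>j\<in>J. g j \<omega>) \<omega>
      = nn_cond_exp M F (\<lambda>\<omega>. g j \<omega> + (\<Sum>j\<in>J. g j \<omega>)) \<omega>"
    using insert.prems by (intro nn_cond_exp_sum) auto
  ultimately show ?case using insert.hyps by auto
qed

text \<open>The constant \<open>prob B\<close> has the right integral over every event of
  \<open>F\<close>, which characterizes the conditional expectation.\<close>

lemma (in prob_space) nn_cond_exp_indep_event:
  assumes F: "subalgebra M F" and B: "B \<in> events"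
    and indep: "\<And>A. A \<in> sets F \<Longrightarrow> prob (A \<inter> B) = prob A * prob B"
  shows "AE \<omega> in M. nn_cond_exp M F (indicator B) \<omega> = ennreal (prob B)"
proof -
  interpret F: finite_measure_subalgebra M F
    using F by unfold_locales
  have "AE \<omega> in M. (\<lambda>_. ennreal (prob B)) \<omega> = nn_cond_exp M F (indicator B) \<omega>"
  proof (rule F.nn_cond_exp_charact)
    fix A assume A: "A \<in> sets F"
    then have [measurable]: "A \<in> events" using F by (auto simp: subalgebra_def)
    have "(\<integral>\<^sup>+\<omega>\<in>A. indicator B \<omega> \<partial>M) = (\<integral>\<^sup>+\<omega>. indicator (A \<inter> B) \<omega> \<partial>M)"
      by (intro nn_integral_cong) (auto split: split_indicator)
    also have "\<dots> = ennreal (prob (A \<inter> B))"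
      using B by (simp add: emeasure_eq_measure)
    also have "\<dots> = ennreal (prob B) * ennreal (prob A)"
      unfolding indep[OF A] by (simp add: ennreal_mult' mult.commute)
    also have "\<dots> = (\<integral>\<^sup>+\<omega>\<in>A. ennreal (prob B) \<partial>M)"
      by (simp add: nn_integral_cmult_indicator emeasure_eq_measure)
    finally show "(\<integral>\<^sup>+\<omega>\<in>A. indicator B \<omega> \<partial>M) = (\<integral>\<^sup>+\<omega>\<in>A. ennreal (prob B) \<partial>M)" .
  qed (use B in auto)
  then show ?thesis by eventually_elim simp
qed

text \<open>Freezing of the known part: split according to the value \<open>j\<close> of
  \<open>T\<close>, pull the \<open>F\<close>-measurable factor \<open>h j\<close> out, and use
  independence of the event that \<open>T\<close> equals \<open>j\<close>.\<close>

lemma (in prob_space) nn_cond_exp_indep_selection: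
  assumes F: "subalgebra M F" and J: "finite J" and T: "T \<in> measurable M (count_space J)"
    and indep: "\<And>A j. A \<in> sets F \<Longrightarrow> j \<in> J \<Longrightarrow>
      prob (A \<inter> {\<omega>\<in>space M. T \<omega> = j}) = prob A * prob {\<omega>\<in>space M. T \<omega> = j}"
    and h: "\<And>j. j \<in> J \<Longrightarrow> h j \<in> borel_measurable F"
  shows "AE \<omega> in M. nn_cond_exp M F (\<lambda>\<omega>. h (T \<omega>) \<omega>) \<omega>
    = (\<Sum>j\<in>J. ennreal (prob {\<omega>\<in>space M. T \<omega> = j}) * h j \<omega>)"
proof -
  interpret F: finite_measure_subalgebra M F
    using F by unfold_locales
  let ?B = "\<lambda>j. {\<omega>\<in>space M. T \<omega> = j}"
  have hM: "\<And>j. j \<in> J \<Longrightarrow> h j \<in> borel_measurable M"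
    using measurable_from_subalg[OF F h] .
  have B[measurable]: "?B j \<in> events" if "j \<in> J" for j
    using measurable_sets[OF T, of "{j}"] that by (simp add: vimage_def Int_def conj_commute)
  have TJ: "T \<omega> \<in> J" if "\<omega> \<in> space M" for \<omega>
    using measurable_space[OF T that] by simp
  have eq: "h (T \<omega>) \<omega> = (\<Sum>j\<in>J. h j \<omega> * indicator (?B j) \<omega>)" if "\<omega> \<in> space M" for \<omega>
  proof -
    have "(\<Sum>j\<in>J. h j \<omega> * indicator (?B j) \<omega>) = (\<Sum>j\<in>{T \<omega>}. h j \<omega> * indicator (?B j) \<omega>)"
      using J TJ[OF that] by (intro sum.mono_neutral_right) auto
    then show ?thesis using that by simp
  qed
  have meas: "(\<lambda>\<omega>. \<Sum>j\<in>J. h j \<omega> * indicator (?B j) \<omega>) \<in> borel_measurable M"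
    using hM by (intro borel_measurable_sum borel_measurable_times_ennreal) auto
  have "AE \<omega> in M. nn_cond_exp M F (\<lambda>\<omega>. h (T \<omega>) \<omega>) \<omega>
      = nn_cond_exp M F (\<lambda>\<omega>. \<Sum>j\<in>J. h j \<omega> * indicator (?B j) \<omega>) \<omega>"
  proof (rule F.nn_cond_exp_cong)
    show "AE \<omega> in M. h (T \<omega>) \<omega> = (\<Sum>j\<in>J. h j \<omega> * indicator (?B j) \<omega>)"
      using eq by auto
    show "(\<lambda>\<omega>. h (T \<omega>) \<omega>) \<in> borel_measurable M"
      using meas by (subst measurable_cong[OF eq]) auto
  qed (rule meas)
  moreover have "AE \<omega> in M. nn_cond_exp M F (\<lambda>\<omega>. \<Sum>j\<in>J. h j \<omega> * indicator (?B j) \<omega>) \<omega>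
      = (\<Sum>j\<in>J. nn_cond_exp M F (\<lambda>\<omega>. h j \<omega> * indicator (?B j) \<omega>) \<omega>)"
    using J hM by (intro F.nn_cond_exp_finite_sum) auto
  moreover have "AE \<omega> in M. \<forall>j\<in>J. h j \<omega> * nn_cond_exp M F (indicator (?B j)) \<omega>
      = nn_cond_exp M F (\<lambda>\<omega>. h j \<omega> * indicator (?B j) \<omega>) \<omega>"
    using J h by (intro AE_finite_allI F.nn_cond_exp_prod) auto
  moreover have "AE \<omega> in M. \<forall>j\<in>J. nn_cond_exp M F (indicator (?B j)) \<omega> = ennreal (prob (?B j))"
    using J indep by (intro AE_finite_allI nn_cond_exp_indep_event F) auto
  ultimately show ?thesis
  proof eventually_elim
    case (elim \<omega>)
    have "(\<Sum>j\<in>J. nn_cond_exp M F (\<lambda>\<omega>. h j \<omega> * indicator (?B j) \<omega>) \<omega>)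
        = (\<Sum>j\<in>J. ennreal (prob (?B j)) * h j \<omega>)"
    proof (rule sum.cong)
      fix j assume "j \<in> J"
      then show "nn_cond_exp M F (\<lambda>\<omega>. h j \<omega> * indicator (?B j) \<omega>) \<omega> = ennreal (prob (?B j)) * h j \<omega>"
        using bspec[OF elim(3)] bspec[OF elim(4)] by (simp add: mult.commute)
    qed simp
    with elim(1,2) show ?case by simp
  qed
qed

text \<open>It brings the expectation in \<open>regularity\<close> into the same finite sum as the
  conditional expectation above.\<close>

lemma (in prob_space) integral_finite_selection:
  fixes g :: "'i \<Rightarrow> real"
  assumes J: "finite J" and T: "T \<in> measurable M (count_space J)"
  shows "(LINT \<omega>|M. g (T \<omega>)) = (\<Sum>j\<in>J. prob {\<omega>\<in>space M. T \<omega> = j} * g j)"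
proof -
  let ?B = "\<lambda>j. {\<omega>\<in>space M. T \<omega> = j}"
  have B[measurable]: "?B j \<in> events" if "j \<in> J" for j
    using measurable_sets[OF T, of "{j}"] that by (simp add: vimage_def Int_def conj_commute)
  have "(LINT \<omega>|M. g (T \<omega>)) = (LINT \<omega>|M. (\<Sum>j\<in>J. indicator (?B j) \<omega> * g j))"
  proof (rule Bochner_Integration.integral_cong)
    fix \<omega> assume "\<omega> \<in> space M"
    then have "(\<Sum>j\<in>J. indicator (?B j) \<omega> * g j) = (\<Sum>j\<in>{T \<omega>}. indicator (?B j) \<omega> * g j)"
      using J measurable_space[OF T] by (intro sum.mono_neutral_right) auto
    then show "g (T \<omega>) = (\<Sum>j\<in>J. indicator (?B j) \<omega> * g j)"
      using \<open>\<omega> \<in> space M\<close> by simp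
  qed simp
  also have "\<dots> = (\<Sum>j\<in>J. LINT \<omega>|M. indicator (?B j) \<omega> * g j)"
    using B by (intro Bochner_Integration.integral_sum integrable_mult_left integrable_real_indicator)
      (auto simp: emeasure_eq_measure)
  also have "\<dots> = (\<Sum>j\<in>J. prob (?B j) * g j)"
    using B by (intro sum.cong) (auto simp: measure_def)
  finally show ?thesis .
qed

section \<open>Summable integrals over a fixed event\<close>

definition restricted_summable :: "'w measure \<Rightarrow> 'w set \<Rightarrow> (nat \<Rightarrow> 'w \<Rightarrow> real) \<Rightarrow> bool" where
  "restricted_summable M A h \<longleftrightarrow> (\<Sum>k. \<integral>\<^sup>+\<omega>\<in>A. ennreal (h k \<omega>) \<partial>M) < \<infinity>"

lemma restricted_summable_mono:
  assumes "restricted_summable M A g" "\<And>k \<omega>. \<omega> \<in> space M \<Longrightarrow> h k \<omega> \<le> g k \<omega>"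
  shows "restricted_summable M A h"
proof -
  have "(\<Sum>k. \<integral>\<^sup>+\<omega>\<in>A. ennreal (h k \<omega>) \<partial>M) \<le> (\<Sum>k. \<integral>\<^sup>+\<omega>\<in>A. ennreal (g k \<omega>) \<partial>M)"
    using assms(2) by (intro suminf_le summableI nn_integral_mono mult_right_mono ennreal_leI) auto
  then show ?thesis using assms(1) unfolding restricted_summable_def by (rule le_less_trans)
qed

lemma restricted_summable_add:
  assumes "restricted_summable M A g" "restricted_summable M A h" "A \<in> sets M"
    and "\<And>k. g k \<in> borel_measurable M" "\<And>k. h k \<in> borel_measurable M"
    and "\<And>k \<omega>. \<omega> \<in> space M \<Longrightarrow> 0 \<le> g k \<omega>" "\<And>k \<omega>. \<omega> \<in> space M \<Longrightarrow> 0 \<le> h k \<omega>"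
  shows "restricted_summable M A (\<lambda>k \<omega>. g k \<omega> + h k \<omega>)"
proof -
  note assms(3-5)[measurable]
  have "(\<integral>\<^sup>+\<omega>\<in>A. ennreal (g k \<omega> + h k \<omega>) \<partial>M)
      = (\<integral>\<^sup>+\<omega>\<in>A. ennreal (g k \<omega>) \<partial>M) + (\<integral>\<^sup>+\<omega>\<in>A. ennreal (h k \<omega>) \<partial>M)" for k
    using assms(6,7)
    by (subst nn_integral_add[symmetric])
      (auto intro!: nn_integral_cong simp: ennreal_plus distrib_right)
  then show ?thesis
    using assms(1,2) by (simp add: restricted_summable_def suminf_add[symmetric] summableI)
qed

lemma restricted_summable_cmult:
  assumes "restricted_summable M A h" "A \<in> sets M" "\<And>k. h k \<in> borel_measurable M" "0 \<le> r"
  shows "restricted_summable M A (\<lambda>k \<omega>. r * h k \<omega>)"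
proof -
  note assms(2-3)[measurable]
  have "(\<integral>\<^sup>+\<omega>\<in>A. ennreal (r * h k \<omega>) \<partial>M) = ennreal r * (\<integral>\<^sup>+\<omega>\<in>A. ennreal (h k \<omega>) \<partial>M)" for k
    using assms(4) by (subst nn_integral_cmult[symmetric]) (auto simp: ennreal_mult' mult.assoc)
  then show ?thesis
    using assms(1) by (simp add: restricted_summable_def ennreal_mult_less_top less_top)
qed

lemma (in prob_space) restricted_summable_const:
  assumes "summable a" "\<And>k. 0 \<le> a k" "A \<in> events"
  shows "restricted_summable M A (\<lambda>k _. a k)"
proof -
  have "(\<integral>\<^sup>+\<omega>\<in>A. ennreal (a k) \<partial>M) \<le> ennreal (a k)" for k
  proof -
    have "(\<integral>\<^sup>+\<omega>\<in>A. ennreal (a k) \<partial>M) = ennreal (a k) * emeasure M A"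
      using assms(3) by (simp add: nn_integral_cmult_indicator)
    also have "\<dots> \<le> ennreal (a k) * 1"
      by (intro mult_left_mono measure_le_1 emeasure_le_1) auto
    finally show ?thesis by simp
  qed
  then have "(\<Sum>k. \<integral>\<^sup>+\<omega>\<in>A. ennreal (a k) \<partial>M) \<le> (\<Sum>k. ennreal (a k))"
    by (intro suminf_le summableI)
  also have "\<dots> < \<infinity>"
    using assms(1,2) by (simp add: suminf_ennreal2)
  finally show ?thesis by (simp add: restricted_summable_def)
qed

lemma restricted_summable_descent:
  assumes "\<And>k. (\<integral>\<^sup>+\<omega>\<in>A. ennreal (Y (Suc k) \<omega>) \<partial>M) + (\<integral>\<^sup>+\<omega>\<in>A. ennreal (b k \<omega>) \<partial>M)
      \<le> (\<integral>\<^sup>+\<omega>\<in>A. ennreal (Y k \<omega>) \<partial>M) + (\<integral>\<^sup>+\<omega>\<in>A. ennreal (c k \<omega>) \<partial>M)"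
    and "(\<integral>\<^sup>+\<omega>\<in>A. ennreal (Y 0 \<omega>) \<partial>M) < \<infinity>" "restricted_summable M A c"
  shows "restricted_summable M A b"
  unfolding restricted_summable_def
  by (rule ennreal_series_bound[where Y = "\<lambda>k. \<integral>\<^sup>+\<omega>\<in>A. ennreal (Y k \<omega>) \<partial>M"
        and c = "\<lambda>k. \<integral>\<^sup>+\<omega>\<in>A. ennreal (c k \<omega>) \<partial>M"])
    (use assms in \<open>auto simp: restricted_summable_def\<close>)

lemma (in prob_space) set_nn_integral_bounded:
  assumes "A \<in> events" "\<And>\<omega>. \<omega> \<in> A \<Longrightarrow> h \<omega> \<le> C"
  shows "(\<integral>\<^sup>+\<omega>\<in>A. ennreal (h \<omega>) \<partial>M) < \<infinity>"
proof -
  have "(\<integral>\<^sup>+\<omega>\<in>A. ennreal (h \<omega>) \<partial>M) \<le> (\<integral>\<^sup>+\<omega>. ennreal C * indicator A \<omega> \<partial>M)"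
    using assms(2) by (intro nn_integral_mono) (auto split: split_indicator intro: ennreal_leI)
  also have "\<dots> = ennreal C * emeasure M A"
    using assms(1) by (simp add: nn_integral_cmult_indicator)
  also have "\<dots> < \<infinity>"
    by (simp add: ennreal_mult_less_top emeasure_eq_measure)
  finally show ?thesis .
qed

lemma set_nn_integral_add_le:
  assumes [measurable]: "A \<in> sets M" "Y \<in> borel_measurable M" "b \<in> borel_measurable M"
      "R \<in> borel_measurable M" "c \<in> borel_measurable M"
    and nonneg: "\<And>\<omega>. \<omega> \<in> space M \<Longrightarrow> 0 \<le> Y \<omega>" "\<And>\<omega>. \<omega> \<in> space M \<Longrightarrow> 0 \<le> b \<omega>"
      "\<And>\<omega>. \<omega> \<in> space M \<Longrightarrow> 0 \<le> R \<omega>" "\<And>\<omega>. \<omega> \<in> space M \<Longrightarrow> 0 \<le> c \<omega>"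
    and le: "\<And>\<omega>. \<omega> \<in> space M \<Longrightarrow> Y \<omega> + b \<omega> \<le> R \<omega> + c \<omega>"
  shows "(\<integral>\<^sup>+\<omega>\<in>A. ennreal (Y \<omega>) \<partial>M) + (\<integral>\<^sup>+\<omega>\<in>A. ennreal (b \<omega>) \<partial>M)
    \<le> (\<integral>\<^sup>+\<omega>\<in>A. ennreal (R \<omega>) \<partial>M) + (\<integral>\<^sup>+\<omega>\<in>A. ennreal (c \<omega>) \<partial>M)"
proof -
  have "(\<integral>\<^sup>+\<omega>\<in>A. ennreal (Y \<omega>) \<partial>M) + (\<integral>\<^sup>+\<omega>\<in>A. ennreal (b \<omega>) \<partial>M)
      = (\<integral>\<^sup>+\<omega>. ennreal (Y \<omega>) * indicator A \<omega> + ennreal (b \<omega>) * indicator A \<omega> \<partial>M)"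
    by (simp add: nn_integral_add)
  also have "\<dots> \<le> (\<integral>\<^sup>+\<omega>. ennreal (R \<omega>) * indicator A \<omega> + ennreal (c \<omega>) * indicator A \<omega> \<partial>M)"
    using nonneg le
    by (intro nn_integral_mono) (auto split: split_indicator simp: ennreal_plus[symmetric] simp del: ennreal_plus intro: ennreal_leI)
  also have "\<dots> = (\<integral>\<^sup>+\<omega>\<in>A. ennreal (R \<omega>) \<partial>M) + (\<integral>\<^sup>+\<omega>\<in>A. ennreal (c \<omega>) \<partial>M)"
    by (simp add: nn_integral_add)
  finally show ?thesis .
qed

text \<open>The bridge between bounds with a subtracted gain and the subtraction-free form used for
  integrals. For infinite \<open>e\<close> both sides are false, since the bounds are
  finite.\<close>

lemma enn2ereal_le_diff_iff:
  assumes "0 \<le> b" "0 \<le> R"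
  shows "enn2ereal e \<le> ereal (R - b) \<longleftrightarrow> e + ennreal b \<le> ennreal R"
proof (cases e)
  case (real r)
  have "e + ennreal b \<le> ennreal R \<longleftrightarrow> r + b \<le> R"
    using real assms by (simp add: ennreal_plus[symmetric] del: ennreal_plus)
  then show ?thesis using real by (auto simp: enn2ereal_ennreal)
next
  case top
  then show ?thesis by (simp add: top_unique)
qed

lemma (in sigma_finite_subalgebra) cond_exp_set_integral_le:
  assumes A: "A \<in> sets F"
    and meas: "Y \<in> borel_measurable M" "b \<in> borel_measurable M" "R \<in> borel_measurable M" "c \<in> borel_measurable M"
    and nonneg: "\<And>\<omega>. \<omega> \<in> space M \<Longrightarrow> 0 \<le> b \<omega>"
      "\<And>\<omega>. \<omega> \<in> space M \<Longrightarrow> 0 \<le> R \<omega>" "\<And>\<omega>. \<omega> \<in> space M \<Longrightarrow> 0 \<le> c \<omega>"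
    and le: "AE \<omega> in M. cond_exp M F Y \<omega> \<le> ereal (R \<omega> - b \<omega> + c \<omega>)"
  shows "(\<integral>\<^sup>+\<omega>\<in>A. ennreal (Y \<omega>) \<partial>M) + (\<integral>\<^sup>+\<omega>\<in>A. ennreal (b \<omega>) \<partial>M)
    \<le> (\<integral>\<^sup>+\<omega>\<in>A. ennreal (R \<omega>) \<partial>M) + (\<integral>\<^sup>+\<omega>\<in>A. ennreal (c \<omega>) \<partial>M)"
proof -
  note meas[measurable]
  have [measurable]: "A \<in> sets M" using A subalg by (auto simp: subalgebra_def)
  have "(\<integral>\<^sup>+\<omega>\<in>A. ennreal (Y \<omega>) \<partial>M) + (\<integral>\<^sup>+\<omega>\<in>A. ennreal (b \<omega>) \<partial>M)
      \<le> (\<integral>\<^sup>+\<omega>\<in>A. (ennreal (R \<omega>) + ennreal (c \<omega>)) \<partial>M)"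
  proof (rule nn_cond_exp_set_integral_le[OF A])
    show "AE \<omega> in M. nn_cond_exp M F (\<lambda>\<omega>. ennreal (Y \<omega>)) \<omega> + ennreal (b \<omega>)
        \<le> ennreal (R \<omega>) + ennreal (c \<omega>)"
      using le AE_space
    proof eventually_elim
      case (elim \<omega>)
      \<comment> \<open>The regrouping makes the minuend \<open>R + c\<close> nonnegative even where
        \<open>R - b\<close> is negative.\<close>
      have eq: "R \<omega> - b \<omega> + c \<omega> = (R \<omega> + c \<omega>) - b \<omega>" by simp
      then show ?case
        using elim(1)[unfolded cond_exp_def eq] nonneg[OF elim(2)]
        by (simp add: enn2ereal_le_diff_iff flip: ennreal_plus)
    qed
  qed auto
  also have "\<dots> = (\<integral>\<^sup>+\<omega>\<in>A. ennreal (R \<omega>) \<partial>M) + (\<integral>\<^sup>+\<omega>\<in>A. ennreal (c \<omega>) \<partial>M)"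
    by (simp add: nn_integral_add distrib_right)
  finally show ?thesis .
qed

section \<open>The algorithm\<close>

text \<open>Existentially given constants become the parameters \<open>c\<close>, \<open>w0\<close>
  and \<open>B\<close>, so that the coefficients can be written explicitly. \<open>B\<close> serves
  all users at once, and connectivity is that of each single graph, which connectivity of the
  intersection over a window implies.\<close>

locale random_proximal_network = prob_space M for M :: "'w measure" +
  fixes m :: nat and I :: "nat \<Rightarrow> nat set"
    and Xs :: "nat \<Rightarrow> nat \<Rightarrow> 'a::euclidean_space set" and f :: "nat \<Rightarrow> 'a \<Rightarrow> real"
    and E :: "nat \<Rightarrow> (nat \<times> nat) set" and w :: "nat \<Rightarrow> nat \<Rightarrow> nat \<Rightarrow> real"
    and \<alpha> :: "nat \<Rightarrow> real" and \<Omega> :: "nat \<Rightarrow> nat \<Rightarrow> 'w \<Rightarrow> nat"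
    and x v :: "nat \<Rightarrow> nat \<Rightarrow> 'w \<Rightarrow> 'a" and xstar :: 'a and c w0 B :: real
  assumes users: "m \<ge> 1"
    and finite_indices: "\<And>i. i \<in> {1..m} \<Longrightarrow> finite (I i)"
    and edges: "\<And>k. E k \<subseteq> {1..m} \<times> {1..m}" "\<And>i k. i \<in> {1..m} \<Longrightarrow> (i, i) \<in> E k"
    and connected: "\<And>k. strongly_connected (user_graph m (E k))"
    and selection: "\<And>i k. i \<in> {1..m} \<Longrightarrow> \<Omega> i k \<in> measurable M (count_space (I i))"
    and initial: "\<And>i. i \<in> {1..m} \<Longrightarrow> x i 0 \<in> borel_measurable M"
    and constraints: "\<And>i j. i \<in> {1..m} \<Longrightarrow> j \<in> I i \<Longrightarrow> closed (Xs i j) \<and> convex (Xs i j)"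
      "feasible m I Xs \<noteq> {}"
    and convex_costs: "\<And>i. i \<in> {1..m} \<Longrightarrow> convex_on UNIV (f i)"
    and B_pos: "0 < B"
    and subgradient_bound: "\<And>i y g. i \<in> {1..m} \<Longrightarrow> y \<in> feasible m I Xs \<Longrightarrow> g \<in> subdifferential (f i) y \<Longrightarrow> norm g \<le> B"
    and independent: "indep_vars (\<lambda>(i, k). count_space (I i)) (\<lambda>(i, k). \<Omega> i k) ({1..m} \<times> UNIV)"
      "indep_set (sigma_sets (space M) (selection_events M m \<Omega> UNIV))
         (sigma_sets (space M) (initial_events M m x))"
    and c_pos: "0 < c"
    and regularity: "\<And>i y k. i \<in> {1..m} \<Longrightarrow>
         (infdist y (feasible m I Xs))\<^sup>2 \<le> c * (LINT \<omega>|M. (infdist y (Xs i (\<Omega> i k \<omega>)))\<^sup>2)"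
    and weights: "\<And>i j k. i \<in> {1..m} \<Longrightarrow> j \<in> {1..m} \<Longrightarrow> w i j k \<ge> 0"
      "\<And>i j k. i \<in> {1..m} \<Longrightarrow> j \<in> {1..m} \<Longrightarrow> j \<notin> neighbours m E i k \<Longrightarrow> w i j k = 0"
      "\<And>i k. i \<in> {1..m} \<Longrightarrow> (\<Sum>j=1..m. w i j k) = 1"
      "\<And>j k. j \<in> {1..m} \<Longrightarrow> (\<Sum>i=1..m. w i j k) = 1"
    and w0: "0 < w0" "w0 < 1" "\<And>i k j. i \<in> {1..m} \<Longrightarrow> j \<in> neighbours m E i k \<Longrightarrow> w i j k \<ge> w0"
    and steps: "\<And>k. \<alpha> k > 0" "summable (\<lambda>k. (\<alpha> k)\<^sup>2)"
    and xstar: "xstar \<in> solutions (total_cost m f) (feasible m I Xs)"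
    and algorithm: "random_projected_proximal M m E w f Xs \<alpha> \<Omega> x v"
begin

abbreviation X :: "'a set" where "X \<equiv> feasible m I Xs"

lemma feasible_subset: "i \<in> {1..m} \<Longrightarrow> j \<in> I i \<Longrightarrow> X \<subseteq> Xs i j"
  by (auto simp: feasible_def user_feasible_def)

lemma closed_X: "closed X" and convex_X: "convex X"
  using constraints(1) unfolding feasible_def user_feasible_def
  by (auto intro!: closed_INT convex_INT)

lemma selection_in: "i \<in> {1..m} \<Longrightarrow> \<omega> \<in> space M \<Longrightarrow> \<Omega> i k \<omega> \<in> I i"
  using measurable_space[OF selection] by simp

lemma v_eq:
  assumes "i \<in> {1..m}" "\<omega> \<in> space M"
  shows "v i k \<omega> = (\<Sum>j=1..m. w i j k *\<^sub>R x j k \<omega>)"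
proof -
  have "v i k \<omega> = (\<Sum>j\<in>neighbours m E i k. w i j k *\<^sub>R x j k \<omega>)"
    using algorithm assms by (auto simp: random_projected_proximal_def)
  also have "\<dots> = (\<Sum>j=1..m. w i j k *\<^sub>R x j k \<omega>)"
    using weights(2)[OF assms(1)] by (intro sum.mono_neutral_left) (auto simp: neighbours_def)
  finally show ?thesis .
qed

definition p :: "nat \<Rightarrow> nat \<Rightarrow> 'w \<Rightarrow> 'a" where
  "p i k \<omega> = prox (\<lambda>y. \<alpha> k * f i y) (v i k \<omega>)"

lemma x_Suc:
  assumes "i \<in> {1..m}" "\<omega> \<in> space M"
  shows "x i (Suc k) \<omega> = closest_point (Xs i (\<Omega> i k \<omega>)) (p i k \<omega>)"
  using algorithm assms by (auto simp: random_projected_proximal_def p_def)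

section \<open>Histories and measurability of the iterates\<close>

lemma initial_events_subset: "initial_events M m x \<subseteq> events"
  unfolding initial_events_def events_of_def by (auto intro!: measurable_sets[OF initial])

text \<open>Since \<open>\<Omega> i l\<close> takes values in \<open>I i\<close>, preimages of
  arbitrary sets of naturals reduce to preimages of subsets of \<open>I i\<close>, the form in which
  independence is given.\<close>

lemma selection_events_eq:
  "selection_events M m \<Omega> T = {\<Omega> i l -` A \<inter> space M | i l A. i \<in> {1..m} \<and> l \<in> T \<and> A \<in> Pow (I i)}"
    (is "_ = ?R")
proof (intro equalityI subsetI)
  fix S assume "S \<in> selection_events M m \<Omega> T"
  then obtain i l A where S: "S = \<Omega> i l -` A \<inter> space M" "i \<in> {1..m}" "l \<in> T"
    unfolding selection_events_def events_of_def by auto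
  have "S = \<Omega> i l -` (A \<inter> I i) \<inter> space M"
    using selection_in[OF S(2)] S(1) by auto
  then show "S \<in> ?R" using S(2,3) by blast
next
  fix S assume "S \<in> ?R"
  then obtain i l A where "S = \<Omega> i l -` A \<inter> space M" "(i, l) \<in> {1..m} \<times> T"
    by blast
  then show "S \<in> selection_events M m \<Omega> T"
    unfolding selection_events_def events_of_def by force
qed

lemma selection_events_subset: "selection_events M m \<Omega> T \<subseteq> events"
  unfolding selection_events_eq by (auto intro!: measurable_sets[OF selection])

lemma selection_events_mono:
  "T \<subseteq> T' \<Longrightarrow> selection_events M m \<Omega> T \<subseteq> selection_events M m \<Omega> T'"
  unfolding selection_events_eq by blast

lemma space_history [simp]: "space (history M m x \<Omega> k) = space M"
  by (simp add: history_def space_measure_of_conv)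

lemma sets_history:
  "sets (history M m x \<Omega> k)
    = sigma_sets (space M) (initial_events M m x \<union> selection_events M m \<Omega> {..<k})"
  unfolding history_def
  using initial_events_subset selection_events_subset[of "{..<k}"] sets.space_closed[of M]
  by (intro sets_measure_of) blast

lemma subalgebra_history: "subalgebra M (history M m x \<Omega> k)"
  using sets.sigma_sets_subset[OF Un_least[OF initial_events_subset selection_events_subset]]
  unfolding subalgebra_def sets_history by simp

lemma subalgebra_history_mono:
  assumes "k \<le> l"
  shows "subalgebra (history M m x \<Omega> l) (history M m x \<Omega> k)"
proof -
  have "initial_events M m x \<union> selection_events M m \<Omega> {..<k}
      \<subseteq> initial_events M m x \<union> selection_events M m \<Omega> {..<l}"
    using selection_events_mono[of "{..<k}" "{..<l}"] assms by auto
  then show ?thesis by (simp add: subalgebra_def sets_history sigma_sets_mono')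
qed

lemma measurable_initial_history:
  assumes "i \<in> {1..m}"
  shows "x i 0 \<in> borel_measurable (history M m x \<Omega> k)"
proof (rule measurableI)
  fix A :: "'a set" assume "A \<in> sets borel"
  then have "x i 0 -` A \<inter> space M \<in> initial_events M m x"
    using assms unfolding initial_events_def events_of_def by blast
  then show "x i 0 -` A \<inter> space (history M m x \<Omega> k) \<in> sets (history M m x \<Omega> k)"
    unfolding space_history sets_history by (intro sigma_sets.Basic UnI1)
qed simp

lemma measurable_selection_history:
  assumes "i \<in> {1..m}" "l < k"
  shows "\<Omega> i l \<in> measurable (history M m x \<Omega> k) (count_space (I i))"
proof (rule measurableI)
  fix A assume "A \<in> sets (count_space (I i))"
  then have "\<Omega> i l -` A \<inter> space M \<in> selection_events M m \<Omega> {..<k}"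
    using assms unfolding selection_events_eq by auto
  then show "\<Omega> i l -` A \<inter> space (history M m x \<Omega> k) \<in> sets (history M m x \<Omega> k)"
    unfolding space_history sets_history by (intro sigma_sets.Basic UnI2)
qed (use assms selection_in in simp)

text \<open>The proximal map and the projections are continuous. The selection at time
  \<open>k\<close> enters the history exactly at \<open>k + 1\<close>, just as it enters the
  iterate.\<close>

lemma measurable_iterates:
  assumes "i \<in> {1..m}"
  shows measurable_x: "x i k \<in> borel_measurable (history M m x \<Omega> k)"
    and measurable_v: "v i k \<in> borel_measurable (history M m x \<Omega> k)"
    and measurable_p: "p i k \<in> borel_measurable (history M m x \<Omega> k)"
proof -
  \<comment> \<open>Stated conditionally on the measurability of all \<open>x\<close> at time
    \<open>k\<close>, so that this and the next claim can be used within the induction.\<close>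
  have v: "v i k \<in> borel_measurable (history M m x \<Omega> k)"
    if "\<forall>i\<in>{1..m}. x i k \<in> borel_measurable (history M m x \<Omega> k)" "i \<in> {1..m}" for i k
  proof -
    have "(\<lambda>\<omega>. \<Sum>j=1..m. w i j k *\<^sub>R x j k \<omega>) \<in> borel_measurable (history M m x \<Omega> k)"
      using that by (intro borel_measurable_sum borel_measurable_scaleR) auto
    then show ?thesis using v_eq[OF that(2)] by (subst measurable_cong) auto
  qed
  have p: "p i k \<in> borel_measurable (history M m x \<Omega> k)"
    if "\<forall>i\<in>{1..m}. x i k \<in> borel_measurable (history M m x \<Omega> k)" "i \<in> {1..m}" for i k
  proof -
    have "convex_on UNIV (\<lambda>y. \<alpha> k * f i y)"
      using steps(1)[of k] convex_costs[OF that(2)] by (intro convex_on_cmul) auto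
    then have "prox (\<lambda>y. \<alpha> k * f i y) \<in> borel_measurable borel"
      by (intro borel_measurable_continuous_onI continuous_on_prox)
    then show ?thesis using v[OF that] unfolding p_def by measurable
  qed
  have x: "\<forall>i\<in>{1..m}. x i k \<in> borel_measurable (history M m x \<Omega> k)" for k
  proof (induction k)
    case 0
    show ?case using measurable_initial_history by auto
  next
    case (Suc k)
    show ?case
    proof
      fix i assume i: "i \<in> {1..m}"
      let ?F = "history M m x \<Omega> (Suc k)"
      have pk: "p i k \<in> borel_measurable ?F"
        using measurable_from_subalg[OF subalgebra_history_mono p[OF Suc i], of "Suc k"] by simp
      \<comment> \<open>The projection set depends on the sample point only through the index, which
        takes finitely many values; for each fixed index the map is measurable.\<close>
      have "(\<lambda>\<omega>. closest_point (Xs i (\<Omega> i k \<omega>)) (p i k \<omega>)) \<in> borel_measurable ?F"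
      proof (rule measurable_compose_countable'[where f = "\<lambda>j \<omega>. closest_point (Xs i j) (p i k \<omega>)"
            and g = "\<Omega> i k" and I = "I i"])
        fix j assume j: "j \<in> I i"
        have "closest_point (Xs i j) \<in> borel_measurable borel"
          using constraints feasible_subset[OF i j] i j
          by (intro borel_measurable_continuous_onI continuous_on_closest_point) auto
        then show "(\<lambda>\<omega>. closest_point (Xs i j) (p i k \<omega>)) \<in> borel_measurable ?F"
          using pk by measurable
      next
        show "\<Omega> i k \<in> measurable ?F (count_space (I i))"
          using i by (intro measurable_selection_history) auto
        show "countable (I i)" using finite_indices[OF i] by (rule countable_finite)
      qed
      then show "x i (Suc k) \<in> borel_measurable ?F"
        using x_Suc[OF i] by (subst measurable_cong) auto
    qed
  qed
  show "x i k \<in> borel_measurable (history M m x \<Omega> k)"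
    and "v i k \<in> borel_measurable (history M m x \<Omega> k)"
    and "p i k \<in> borel_measurable (history M m x \<Omega> k)"
    using x v p assms by auto
qed

lemmas measurable_iterates_M [measurable] =
  measurable_iterates[THEN measurable_from_subalg[OF subalgebra_history]]

section \<open>Independence of the current selection from the past\<close>

text \<open>The index \<open>None\<close> stands for all the initial points together.\<close>

lemma indep_initial_selections:
  defines "G \<equiv> \<lambda>t. case t of None \<Rightarrow> sigma_sets (space M) (initial_events M m x)
    | Some (i, k) \<Rightarrow> {\<Omega> i k -` A \<inter> space M | A. A \<in> Pow (I i)}"
  shows "indep_sets G (insert None (Some ` ({1..m} \<times> UNIV)))"
proof (rule indep_setsI)
  have sel: "G (Some (i, k)) \<subseteq> selection_events M m \<Omega> UNIV" if "i \<in> {1..m}" for i k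
    using that unfolding G_def selection_events_eq by auto
  show "G t \<subseteq> events" if "t \<in> insert None (Some ` ({1..m} \<times> UNIV))" for t
  proof (cases t)
    case None
    then show ?thesis using sets.sigma_sets_subset[OF initial_events_subset] by (simp add: G_def)
  next
    case (Some ik)
    then show ?thesis using that sel selection_events_subset by blast
  qed
  fix A J assume J: "J \<noteq> {}" "J \<subseteq> insert None (Some ` ({1..m} \<times> UNIV))" "finite J"
    and A: "\<forall>t\<in>J. A t \<in> G t"
  \<comment> \<open>The selections occurring in \<open>J\<close>, with \<open>None\<close> set
    aside: the product rule among them is the first independence assumption.\<close>
  define K where "K = {ik. Some ik \<in> J}"
  have K: "K \<subseteq> {1..m} \<times> UNIV" "finite K" "J - {None} = Some ` K"
    using J unfolding K_def by (auto simp: finite_vimageI[of J Some, unfolded vimage_def] image_iff)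
  have prod: "prob (\<Inter>t\<in>Some ` K. A t) = (\<Prod>t\<in>Some ` K. prob (A t))" if "K \<noteq> {}"
  proof -
    have "indep_sets (\<lambda>i. {(case i of (i, k) \<Rightarrow> \<Omega> i k) -` A \<inter> space M |A. A \<in> sets (case i of (i, k) \<Rightarrow> count_space (I i))})
        ({1..m} \<times> UNIV)"
      using independent(1) unfolding indep_vars_def2 by blast
    from indep_setsD[OF this K(1) that K(2), of "\<lambda>ik. A (Some ik)"]
    have "prob (\<Inter>ik\<in>K. A (Some ik)) = (\<Prod>ik\<in>K. prob (A (Some ik)))"
      using A K(3) unfolding G_def by (fastforce simp: K_def split: prod.splits)
    then show ?thesis by (simp add: prod.reindex image_image)
  qed
  show "prob (\<Inter>t\<in>J. A t) = (\<Prod>t\<in>J. prob (A t))"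
  \<comment> \<open>If \<open>None\<close> occurs, the second independence assumption splits off its
    factor, provided the intersection of the selection events is recognized as a member of the
    generated sigma-algebra.\<close>
  proof (cases "None \<in> J")
    case False
    then have "J = Some ` K" using K(3) by auto
    then show ?thesis using prod J(1) by auto
  next
    case True
    then have J_eq: "J = insert None (Some ` K)" using K(3) by auto
    show ?thesis
    proof (cases "K = {}")
      case False
      have "(\<Inter>t\<in>Some ` K. A t) \<in> sigma_sets (space M) (selection_events M m \<Omega> UNIV)"
      proof -
        \<comment> \<open>Intersections over several indices leave the generating family, so the
          argument moves to the sigma-algebra, which is closed under them.\<close>
        have "A t \<in> sets (sigma (space M) (selection_events M m \<Omega> UNIV))" if t: "t \<in> Some ` K" for t
        proof -
          obtain i k where ik: "t = Some (i, k)" "(i, k) \<in> K" using t by auto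
          then have "A t \<in> G (Some (i, k))" using A J_eq by auto
          moreover have "i \<in> {1..m}" using ik(2) K(1) by blast
          ultimately have "A t \<in> selection_events M m \<Omega> UNIV" using sel by blast
          then show ?thesis
            using selection_events_subset[of UNIV] sets.space_closed[of M]
            by (subst sets_measure_of) (auto intro: sigma_sets.Basic)
        qed
        then have "(\<Inter>t\<in>Some ` K. A t) \<in> sets (sigma (space M) (selection_events M m \<Omega> UNIV))"
          using K(2) False by (intro sets.finite_INT) auto
        then show ?thesis
          using selection_events_subset[of UNIV] sets.space_closed[of M] by (subst (asm) sets_measure_of) auto
      qed
      moreover have "A None \<in> sigma_sets (space M) (initial_events M m x)"
        using A True by (force simp: G_def)
      ultimately have "prob ((\<Inter>t\<in>Some ` K. A t) \<inter> A None) = prob (\<Inter>t\<in>Some ` K. A t) * prob (A None)"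
        by (rule indep_setD[OF independent(2)])
      then show ?thesis
        using prod[OF False] K(2) by (simp add: J_eq Int_commute mult.commute)
    qed (simp add: J_eq)
  qed
qed

text \<open>The index set is split into two disjoint blocks: the selection of user \<open>i\<close>
  at time \<open>k\<close>, and the initial points with all selections before time \<open>k\<close>.
  The sigma-algebras generated by the blocks are independent, and the second contains the
  history.\<close>

lemma indep_selection_history:
  assumes i: "i \<in> {1..m}" and A: "A \<in> sets (history M m x \<Omega> k)" and j: "j \<in> I i"
  shows "prob (A \<inter> {\<omega>\<in>space M. \<Omega> i k \<omega> = j}) = prob A * prob {\<omega>\<in>space M. \<Omega> i k \<omega> = j}"
proof -
  define G where "G = (\<lambda>t. case t of None \<Rightarrow> sigma_sets (space M) (initial_events M m x)
    | Some (i, k) \<Rightarrow> {\<Omega> i k -` A \<inter> space M | A. A \<in> Pow (I i)})"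
  \<comment> \<open>\<open>True\<close> labels the present selection and \<open>False\<close> the
    past; the blocks are disjoint because the past stops strictly before \<open>k\<close>.\<close>
  define H where "H = (\<lambda>b. if b then {Some (i, k)} else insert None (Some ` ({1..m} \<times> {..<k})))"
  have "indep_sets (\<lambda>b. sigma_sets (space M) (\<Union>t\<in>H b. G t)) UNIV"
  proof (rule indep_sets_collect_sigma)
    show "indep_sets G (\<Union>b. H b)"
      using i unfolding G_def
      by (intro indep_sets_mono_index[OF _ indep_initial_selections]) (auto simp: H_def split: if_splits)
    \<comment> \<open>Stability under intersections allows independence to pass from the families to
      the sigma-algebras they generate.\<close>
    show "Int_stable (G t)" if "t \<in> H b" for t b
    proof (cases t)
      case None
      have "Int_stable (sets (sigma (space M) (initial_events M m x)))"
        by (rule sets.Int_stable)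
      then show ?thesis
        using None initial_events_subset sets.space_closed[of M]
        by (subst (asm) sets_measure_of) (auto simp: G_def)
    next
      case (Some ik)
      have "\<exists>C. \<Omega> i k -` A \<inter> space M \<inter> (\<Omega> i k -` A' \<inter> space M) = \<Omega> i k -` C \<inter> space M \<and> C \<subseteq> I i"
        if "A \<subseteq> I i" for i k A A'
        using that by (intro exI[of _ "A \<inter> A'"]) auto
      then show ?thesis using Some by (cases ik) (auto simp: G_def Int_stable_def)
    qed
    show "disjoint_family_on H UNIV"
      by (auto simp: disjoint_family_on_def H_def)
  qed
  moreover have "A \<in> sigma_sets (space M) (\<Union>t\<in>H False. G t)"
  proof -
    have "sigma_sets (space M) (initial_events M m x \<union> selection_events M m \<Omega> {..<k})
        \<subseteq> sigma_sets (space M) (\<Union>t\<in>H False. G t)"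
      by (rule sigma_sets_mono') (auto simp: H_def G_def selection_events_eq intro: sigma_sets.Basic; blast)
    then show ?thesis using A by (auto simp: sets_history)
  qed
  moreover have "{\<omega>\<in>space M. \<Omega> i k \<omega> = j} \<in> sigma_sets (space M) (\<Union>t\<in>H True. G t)"
    using j by (auto simp: H_def G_def intro!: sigma_sets.Basic exI[of _ "{j}"])
  \<comment> \<open>The product over the two booleans is the product of the two
    probabilities.\<close>
  ultimately have "prob (\<Inter>b\<in>UNIV. if b then {\<omega>\<in>space M. \<Omega> i k \<omega> = j} else A)
      = (\<Prod>b\<in>UNIV. prob (if b then {\<omega>\<in>space M. \<Omega> i k \<omega> = j} else A))"
    by (intro indep_setsD) auto
  then show ?thesis by (simp add: UNIV_bool Int_commute mult.commute)
qed


section \<open>The two conditional inequalities\<close>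

abbreviation \<gamma> :: "nat \<Rightarrow> nat \<Rightarrow> 'w \<Rightarrow> real" where
  "\<gamma> j k \<omega> \<equiv> gamma m f X (\<alpha> k) (\<lambda>i. v i k \<omega>) j"

text \<open>\<open>\<beta> 1\<close> is the gain \<open>1 / (4 * c)\<close> from regularity minus
  the \<open>1 / (8 * c)\<close> spent on Young's inequality; \<open>\<beta> 2\<close> is likewise
  \<open>1 / 2 - 1 / 4\<close>. \<open>\<beta> 3\<close> collects the remainders of all
  \<open>m\<close> users, \<open>\<beta> 4\<close> is \<open>2 * B\<close> times the factor 2 of
  \<open>sum_norm_average_le\<close>, and the last value is the factor 2 of
  \<open>prox_le\<close>.\<close>

definition \<beta> :: "nat \<Rightarrow> real" where
  "\<beta> j = (if j = 1 then 1 / (8 * c) else if j = 2 then 1 / 4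
    else if j = 3 then real m * ((4 + 8 * c) * B\<^sup>2) else if j = 4 then 4 * B else 2)"

lemma \<beta>_pos: "0 < \<beta> j"
  using c_pos B_pos users by (auto simp: \<beta>_def intro!: mult_pos_pos add_pos_pos)

text \<open>The optimal value is attained at \<open>xstar\<close>, hence finite, so its conversion
  to a real loses nothing.\<close>

lemma total_cost_xstar: "xstar \<in> X" "real_of_ereal (optimal_value (total_cost m f) X) = total_cost m f xstar"
  using xstar by (auto simp: solutions_def) (metis real_of_ereal.simps(1))

lemma total_cost_xstar_le:
  assumes "y \<in> X"
  shows "total_cost m f xstar \<le> total_cost m f y"
proof -
  have "ereal (total_cost m f xstar) = (INF x\<in>X. ereal (total_cost m f x))"
    using xstar by (simp add: solutions_def optimal_value_def)
  also have "\<dots> \<le> ereal (total_cost m f y)"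
    using assms by (rule INF_lower)
  finally show ?thesis by simp
qed

abbreviation z :: "nat \<Rightarrow> nat \<Rightarrow> 'w \<Rightarrow> 'a" where
  "z i k \<omega> \<equiv> closest_point X (v i k \<omega>)"

text \<open>Feasibility of this average makes \<open>\<gamma> 5\<close> nonnegative and permits the
  subgradient bound at it.\<close>

lemma average_z_in: "average m (\<lambda>i. z i k \<omega>) \<in> X"
proof -
  have "(\<Sum>i=1..m. (1 / real m) *\<^sub>R z i k \<omega>) \<in> X"
    using users closed_X convex_X constraints(2) by (intro convex_sum closest_point_in_set) auto
  then show ?thesis by (simp add: average_def scaleR_right.sum)
qed

lemma \<gamma>_simps:
  "\<gamma> 1 k \<omega> = (\<Sum>i=1..m. (infdist (v i k \<omega>) X)\<^sup>2)"
  "\<gamma> 2 k \<omega> = (\<Sum>i=1..m. (norm (v i k \<omega> - p i k \<omega>))\<^sup>2)"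
  "\<gamma> 3 k \<omega> = (\<alpha> k)\<^sup>2"
  "\<gamma> 4 k \<omega> = \<alpha> k * (\<Sum>i=1..m. norm (v i k \<omega> - average m (\<lambda>i. v i k \<omega>)))"
  "\<gamma> 5 k \<omega> = \<alpha> k * (total_cost m f (average m (\<lambda>i. z i k \<omega>)) - total_cost m f xstar)"
  by (simp_all add: gamma_def p_def total_cost_xstar)

lemma \<gamma>_nonneg:
  assumes "j \<in> {1..5}"
  shows "0 \<le> \<gamma> j k \<omega>"
proof -
  have "j = 1 \<or> j = 2 \<or> j = 3 \<or> j = 4 \<or> j = 5" using assms by auto
  then show ?thesis
    using steps(1)[of k] total_cost_xstar_le[OF average_z_in[of k \<omega>]]
    by (elim disjE; simp only: \<gamma>_simps) (auto intro!: sum_nonneg mult_nonneg_nonneg)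
qed

lemma measurable_\<gamma>:
  assumes "j \<in> {1..5}"
  shows "\<gamma> j k \<in> borel_measurable (history M m x \<Omega> k)"
proof -
  let ?F = "history M m x \<Omega> k"
  have v[measurable]: "v i k \<in> borel_measurable ?F" if "i \<in> {1..m}" for i
    using that by (rule measurable_v)
  have p[measurable]: "p i k \<in> borel_measurable ?F" if "i \<in> {1..m}" for i
    using that by (rule measurable_p)
  have inf[measurable]: "(\<lambda>y. infdist y X) \<in> borel_measurable borel"
    by (intro borel_measurable_continuous_onI continuous_intros)
  have cp[measurable]: "closest_point X \<in> borel_measurable borel"
    using closed_X convex_X constraints(2)
    by (intro borel_measurable_continuous_onI continuous_on_closest_point)
  have f[measurable]: "f i \<in> borel_measurable borel" if "i \<in> {1..m}" for i
    using convex_costs[OF that] by (intro borel_measurable_continuous_onI convex_on_continuous) auto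
  have av: "(\<lambda>\<omega>. average m (\<lambda>i. v i k \<omega>)) \<in> borel_measurable ?F"
    unfolding average_def by measurable
  have az: "(\<lambda>\<omega>. average m (\<lambda>i. z i k \<omega>)) \<in> borel_measurable ?F"
    unfolding average_def by measurable
  have "total_cost m f \<in> borel_measurable borel"
    unfolding total_cost_def by measurable
  note this[measurable] av[measurable] az[measurable]
  have "j = 1 \<or> j = 2 \<or> j = 3 \<or> j = 4 \<or> j = 5" using assms by auto
  then show ?thesis
    by (elim disjE) (simp_all only: \<gamma>_simps, measurable)
qed

text \<open>Two feasible points are left free: distances are measured to \<open>y\<close>, and the
  subgradient bound is used at \<open>q\<close>, because the proximal point may be infeasible. The
  choice \<open>y = q = z i k \<omega>\<close> removes the cost terms; \<open>y = xstar\<close> with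
  \<open>q\<close> the average of the projections produces the optimality gap.\<close>

lemma user_step:
  assumes i: "i \<in> {1..m}" and \<omega>: "\<omega> \<in> space M" and y: "y \<in> X" and q: "q \<in> X"
  shows "(norm (x i (Suc k) \<omega> - y))\<^sup>2 + (norm (v i k \<omega> - p i k \<omega>))\<^sup>2 / 4
      + (infdist (v i k \<omega>) (Xs i (\<Omega> i k \<omega>)))\<^sup>2 / 4
    \<le> (norm (v i k \<omega> - y))\<^sup>2 + (infdist (v i k \<omega>) X)\<^sup>2 / (8 * c) + (4 + 8 * c) * B\<^sup>2 * (\<alpha> k)\<^sup>2
      + 2 * \<alpha> k * (f i y - f i q) + 2 * \<alpha> k * B * norm (z i k \<omega> - q)"
proof -
  define a where "a = \<alpha> k"
  have a: "0 < a" using steps(1) by (simp add: a_def)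
  define C where "C = Xs i (\<Omega> i k \<omega>)"
  have \<Omega>: "\<Omega> i k \<omega> \<in> I i" using selection_in[OF i \<omega>] .
  have C: "closed C" "convex C" "y \<in> C"
    using constraints(1)[OF i \<Omega>] feasible_subset[OF i \<Omega>] y by (auto simp: C_def)
  define r where "r = norm (v i k \<omega> - p i k \<omega>)"
  define d where "d = infdist (v i k \<omega>) X"
  have d: "d = norm (v i k \<omega> - z i k \<omega>)"
    unfolding d_def using closed_X constraints(2) by (rule infdist_closest_point)
  \<comment> \<open>The way from \<open>p\<close> to \<open>q\<close> goes through \<open>v\<close>
    and its projection, so that each piece belongs to one of the quantities
    \<open>\<gamma>\<close>.\<close>
  have "norm (p i k \<omega> - q) \<le> r + d + norm (z i k \<omega> - q)"
  proof -
    have "norm (p i k \<omega> - q) = norm ((p i k \<omega> - v i k \<omega>) + (v i k \<omega> - z i k \<omega>) + (z i k \<omega> - q))" by simp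
    also have "\<dots> \<le> norm (p i k \<omega> - v i k \<omega>) + norm (v i k \<omega> - z i k \<omega>) + norm (z i k \<omega> - q)"
      by (intro order.trans[OF norm_triangle_ineq] add_mono norm_triangle_ineq order_refl)
    finally show ?thesis by (simp add: r_def d norm_minus_commute)
  qed
  then have "B * norm (p i k \<omega> - q) \<le> B * (r + d + norm (z i k \<omega> - q))"
    using B_pos by (intro mult_left_mono) auto
  moreover have "f i q - f i (p i k \<omega>) \<le> B * norm (p i k \<omega> - q)"
    using convex_diff_ge[OF convex_costs[OF i]] subgradient_bound[OF i q] by blast
  ultimately have "f i y - f i (p i k \<omega>) \<le> (f i y - f i q) + B * (r + d + norm (z i k \<omega> - q))" by linarith
  then have "2 * a * (f i y - f i (p i k \<omega>)) \<le> 2 * a * ((f i y - f i q) + B * (r + d + norm (z i k \<omega> - q)))"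
    using a by (intro mult_left_mono) auto
  also have "\<dots> = 2 * a * (f i y - f i q) + 2 * a * B * norm (z i k \<omega> - q) + 2 * a * B * r + 2 * a * B * d"
    by (simp add: algebra_simps)
  finally have cost: "2 * a * (f i y - f i (p i k \<omega>))
      \<le> 2 * a * (f i y - f i q) + 2 * a * B * norm (z i k \<omega> - q) + 2 * a * B * r + 2 * a * B * d" .
  \<comment> \<open>Young's inequality; the weight \<open>1 / (8 * c)\<close> is half of the gain \<open>1 / (4 * c)\<close> that
    \<open>regularity\<close> provides once the expectation over \<open>\<Omega> i k\<close> is taken.\<close>
  have r: "2 * a * B * r \<le> r\<^sup>2 / 4 + 4 * B\<^sup>2 * a\<^sup>2"
    using zero_le_power2[of "r / 2 - 2 * a * B"] by (simp add: power2_eq_square algebra_simps)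
  have "0 \<le> (d - 8 * c * (a * B))\<^sup>2 / (8 * c)" using c_pos by simp
  also have "\<dots> = d\<^sup>2 / (8 * c) + 8 * c * B\<^sup>2 * a\<^sup>2 - 2 * a * B * d"
    using c_pos by (simp add: power2_eq_square field_simps)
  finally have d': "2 * a * B * d \<le> d\<^sup>2 / (8 * c) + 8 * c * B\<^sup>2 * a\<^sup>2" by simp
  have "(norm (x i (Suc k) \<omega> - y))\<^sup>2 + r\<^sup>2 / 2 + (infdist (v i k \<omega>) C)\<^sup>2 / 4
      \<le> (norm (v i k \<omega> - y))\<^sup>2 + 2 * a * (f i y - f i (p i k \<omega>))"
    using proximal_projection_step[OF convex_costs[OF i] a C, of "v i k \<omega>"]
    by (simp add: x_Suc[OF i \<omega>] r_def p_def a_def C_def)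
  moreover have "(4 + 8 * c) * B\<^sup>2 * a\<^sup>2 = 4 * B\<^sup>2 * a\<^sup>2 + 8 * c * B\<^sup>2 * a\<^sup>2"
    by (simp add: algebra_simps)
  ultimately show ?thesis
    unfolding r_def[symmetric] d_def[symmetric] a_def[symmetric] C_def[symmetric]
    using cost r d' by linarith
qed

text \<open>\<open>R\<close> is known at time \<open>k\<close>, so conditioning leaves it alone,
  while the squared distances to the randomly chosen sets become at least
  \<open>\<gamma> 1 k / (4 * c)\<close>. Everything stays nonnegative and additive until the end,
  hence no integrability is involved.\<close>

lemma cond_exp_descent:
  assumes Y: "Y \<in> borel_measurable M" "\<And>\<omega>. \<omega> \<in> space M \<Longrightarrow> 0 \<le> Y \<omega>"
    and R: "R \<in> borel_measurable (history M m x \<Omega> k)"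
    and le: "\<And>\<omega>. \<omega> \<in> space M \<Longrightarrow>
      Y \<omega> + (\<Sum>i=1..m. (infdist (v i k \<omega>) (Xs i (\<Omega> i k \<omega>)))\<^sup>2 / 4) \<le> R \<omega>"
  shows "AE \<omega> in M. cond_exp M (history M m x \<Omega> k) Y \<omega> \<le> ereal (R \<omega> - \<gamma> 1 k \<omega> / (4 * c))"
proof -
  let ?F = "history M m x \<Omega> k"
  interpret F: finite_measure_subalgebra M ?F
    by unfold_locales (rule subalgebra_history)
  define h where "h = (\<lambda>i j \<omega>. ennreal ((infdist (v i k \<omega>) (Xs i j))\<^sup>2 / 4))"
  define Z where "Z = (\<lambda>i \<omega>. h i (\<Omega> i k \<omega>) \<omega>)"
  have inf: "(\<lambda>y. infdist y S) \<in> borel_measurable borel" for S :: "'a set"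
    by (intro borel_measurable_continuous_onI continuous_intros)
  have h: "h i j \<in> borel_measurable ?F" if "i \<in> {1..m}" for i j
    unfolding h_def using measurable_compose[OF measurable_v[OF that] inf] by measurable
  have Z: "Z i \<in> borel_measurable M" if "i \<in> {1..m}" for i
    unfolding Z_def
  proof (rule measurable_compose_countable'[where f = "h i" and g = "\<Omega> i k" and I = "I i"])
    show "h i j \<in> borel_measurable M" for j
      by (rule measurable_from_subalg[OF subalgebra_history h[OF that]])
  qed (use selection[OF that] finite_indices[OF that] in \<open>auto intro: countable_finite\<close>)
  have nnZ: "AE \<omega> in M. ennreal ((infdist (v i k \<omega>) X)\<^sup>2 / (4 * c)) \<le> nn_cond_exp M ?F (Z i) \<omega>"
    if i: "i \<in> {1..m}" for i
  proof -
    have "AE \<omega> in M. nn_cond_exp M ?F (Z i) \<omega>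
        = (\<Sum>j\<in>I i. ennreal (prob {\<omega>\<in>space M. \<Omega> i k \<omega> = j}) * h i j \<omega>)"
      unfolding Z_def
      using subalgebra_history finite_indices[OF i] selection[OF i] indep_selection_history[OF i] h[OF i]
      by (rule nn_cond_exp_indep_selection)
    then show ?thesis
    proof eventually_elim
      case (elim \<omega>)
      have "(infdist (v i k \<omega>) X)\<^sup>2 / (4 * c) \<le> (LINT \<omega>'|M. (infdist (v i k \<omega>) (Xs i (\<Omega> i k \<omega>')))\<^sup>2) / 4"
        using regularity[OF i, of "v i k \<omega>" k] c_pos by (simp add: field_simps)
      also have "\<dots> = (\<Sum>j\<in>I i. prob {\<omega>\<in>space M. \<Omega> i k \<omega> = j} * ((infdist (v i k \<omega>) (Xs i j))\<^sup>2 / 4))"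
        using integral_finite_selection[OF finite_indices[OF i] selection[OF i],
            of "\<lambda>j. (infdist (v i k \<omega>) (Xs i j))\<^sup>2" k]
        by (simp add: sum_divide_distrib)
      finally have "ennreal ((infdist (v i k \<omega>) X)\<^sup>2 / (4 * c))
          \<le> ennreal (\<Sum>j\<in>I i. prob {\<omega>\<in>space M. \<Omega> i k \<omega> = j} * ((infdist (v i k \<omega>) (Xs i j))\<^sup>2 / 4))"
        by (rule ennreal_leI)
      also have "\<dots> = (\<Sum>j\<in>I i. ennreal (prob {\<omega>\<in>space M. \<Omega> i k \<omega> = j}) * h i j \<omega>)"
        by (subst sum_ennreal[symmetric])
          (auto simp only: h_def ennreal_mult'[OF measure_nonneg] intro!: mult_nonneg_nonneg measure_nonneg divide_nonneg_pos zero_le_power2)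
      finally show ?case using elim by simp
    qed
  qed
  have YZ: "(\<lambda>\<omega>. ennreal (Y \<omega>)) \<in> borel_measurable M" "(\<lambda>\<omega>. \<Sum>i=1..m. Z i \<omega>) \<in> borel_measurable M"
    using Y(1) Z by auto
  have RM: "(\<lambda>\<omega>. ennreal (R \<omega>)) \<in> borel_measurable ?F"
    using R by measurable
  have "AE \<omega> in M. \<forall>i\<in>{1..m}. ennreal ((infdist (v i k \<omega>) X)\<^sup>2 / (4 * c)) \<le> nn_cond_exp M ?F (Z i) \<omega>"
    using nnZ by (intro AE_finite_allI) auto
  moreover have "AE \<omega> in M. nn_cond_exp M ?F (\<lambda>\<omega>. \<Sum>i=1..m. Z i \<omega>) \<omega> = (\<Sum>i=1..m. nn_cond_exp M ?F (Z i) \<omega>)"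
    using Z by (intro F.nn_cond_exp_finite_sum) auto
  \<comment> \<open>The random gain stays on the left with \<open>Y\<close>; it is subtracted only
    after it has been replaced by a finite lower bound.\<close>
  moreover have "AE \<omega> in M. nn_cond_exp M ?F (\<lambda>\<omega>. ennreal (Y \<omega>)) \<omega> + nn_cond_exp M ?F (\<lambda>\<omega>. \<Sum>i=1..m. Z i \<omega>) \<omega>
      = nn_cond_exp M ?F (\<lambda>\<omega>. ennreal (Y \<omega>) + (\<Sum>i=1..m. Z i \<omega>)) \<omega>"
    using YZ by (rule F.nn_cond_exp_sum)
  moreover have "AE \<omega> in M. nn_cond_exp M ?F (\<lambda>\<omega>. ennreal (Y \<omega>) + (\<Sum>i=1..m. Z i \<omega>)) \<omega>
      \<le> nn_cond_exp M ?F (\<lambda>\<omega>. ennreal (R \<omega>)) \<omega>"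
  proof (rule F.nn_cond_exp_mono)
    show "AE \<omega> in M. ennreal (Y \<omega>) + (\<Sum>i=1..m. Z i \<omega>) \<le> ennreal (R \<omega>)"
    proof (rule AE_I2)
      fix \<omega> assume \<omega>: "\<omega> \<in> space M"
      have "ennreal (Y \<omega>) + (\<Sum>i=1..m. Z i \<omega>)
          = ennreal (Y \<omega> + (\<Sum>i=1..m. (infdist (v i k \<omega>) (Xs i (\<Omega> i k \<omega>)))\<^sup>2 / 4))"
        using Y(2)[OF \<omega>] by (simp add: Z_def h_def sum_nonneg sum_ennreal ennreal_plus)
      also have "\<dots> \<le> ennreal (R \<omega>)" using le[OF \<omega>] by (rule ennreal_leI)
      finally show "ennreal (Y \<omega>) + (\<Sum>i=1..m. Z i \<omega>) \<le> ennreal (R \<omega>)" .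
    qed
    show "(\<lambda>\<omega>. ennreal (R \<omega>)) \<in> borel_measurable M"
      by (rule measurable_from_subalg[OF subalgebra_history RM])
  qed (use YZ in auto)
  moreover have "AE \<omega> in M. ennreal (R \<omega>) = nn_cond_exp M ?F (\<lambda>\<omega>. ennreal (R \<omega>)) \<omega>"
    using RM by (rule F.nn_cond_exp_F_meas)
  ultimately show ?thesis
    using AE_space
  proof eventually_elim
    case (elim \<omega>)
    have R_nonneg: "0 \<le> R \<omega>"
    proof -
      have "0 \<le> Y \<omega> + (\<Sum>i=1..m. (infdist (v i k \<omega>) (Xs i (\<Omega> i k \<omega>)))\<^sup>2 / 4)"
        using Y(2)[OF elim(6)] by (intro add_nonneg_nonneg sum_nonneg) auto
      then show ?thesis using le[OF elim(6)] by linarith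
    qed
    have "ennreal (\<gamma> 1 k \<omega> / (4 * c)) = (\<Sum>i=1..m. ennreal ((infdist (v i k \<omega>) X)\<^sup>2 / (4 * c)))"
      using c_pos by (simp add: \<gamma>_simps sum_divide_distrib sum_ennreal del: One_nat_def)
    also have "\<dots> \<le> (\<Sum>i=1..m. nn_cond_exp M ?F (Z i) \<omega>)"
      using elim(1) by (intro sum_mono) auto
    finally have "nn_cond_exp M ?F (\<lambda>\<omega>. ennreal (Y \<omega>)) \<omega> + ennreal (\<gamma> 1 k \<omega> / (4 * c))
        \<le> nn_cond_exp M ?F (\<lambda>\<omega>. ennreal (Y \<omega>)) \<omega> + (\<Sum>i=1..m. nn_cond_exp M ?F (Z i) \<omega>)"
      by (rule add_left_mono)
    also have "\<dots> \<le> ennreal (R \<omega>)"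
      using elim(2-5) by simp
    finally show ?case
      using c_pos \<gamma>_nonneg[of 1 k \<omega>] R_nonneg
      by (simp add: cond_exp_def enn2ereal_le_diff_iff del: One_nat_def)
  qed
qed

text \<open>Row sums equal to one give Jensen's inequality for each user; after exchanging the sums,
  column sums equal to one restore the total.\<close>

lemma sum_v_le:
  assumes "\<omega> \<in> space M"
  shows "(\<Sum>i=1..m. (infdist (v i k \<omega>) X)\<^sup>2) \<le> (\<Sum>i=1..m. (infdist (x i k \<omega>) X)\<^sup>2)"
    and "(\<Sum>i=1..m. (norm (v i k \<omega> - y))\<^sup>2) \<le> (\<Sum>i=1..m. (norm (x i k \<omega> - y))\<^sup>2)"
proof -
  have avg: "(\<Sum>i=1..m. g (v i k \<omega>)) \<le> (\<Sum>i=1..m. g (x i k \<omega>))"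
    if "\<And>i. i \<in> {1..m} \<Longrightarrow> g (v i k \<omega>) \<le> (\<Sum>j=1..m. w i j k * g (x j k \<omega>))" for g :: "'a \<Rightarrow> real"
  proof -
    have "(\<Sum>i=1..m. g (v i k \<omega>)) \<le> (\<Sum>i=1..m. \<Sum>j=1..m. w i j k * g (x j k \<omega>))"
      using that by (rule sum_mono)
    also have "\<dots> = (\<Sum>j=1..m. (\<Sum>i=1..m. w i j k) * g (x j k \<omega>))"
      by (subst sum.swap) (simp add: sum_distrib_right)
    finally show ?thesis using weights(4) by simp
  qed
  show "(\<Sum>i=1..m. (infdist (v i k \<omega>) X)\<^sup>2) \<le> (\<Sum>i=1..m. (infdist (x i k \<omega>) X)\<^sup>2)"
    using weights(1,3) closed_X convex_X constraints(2)
    by (intro avg) (auto simp: v_eq[OF _ assms] intro!: infdist_sq_weighted_le)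
  show "(\<Sum>i=1..m. (norm (v i k \<omega> - y))\<^sup>2) \<le> (\<Sum>i=1..m. (norm (x i k \<omega> - y))\<^sup>2)"
    using weights(1,3)
    by (intro avg[of "\<lambda>u. (norm (u - y))\<^sup>2"]) (auto simp: v_eq[OF _ assms] intro!: weighted_norm_sq_le)
qed

lemma cond_exp_infdist_le:
  "AE \<omega> in M. cond_exp M (history M m x \<Omega> k) (\<lambda>\<omega>. \<Sum>i=1..m. (infdist (x i (Suc k) \<omega>) X)\<^sup>2) \<omega>
    \<le> ereal ((\<Sum>i=1..m. (infdist (x i k \<omega>) X)\<^sup>2) - (\<Sum>j\<in>{1,2}. \<beta> j * \<gamma> j k \<omega>) + \<beta> 3 * \<gamma> 3 k \<omega>)"
proof -
  \<comment> \<open>The pathwise bound, before the gain of \<open>cond_exp_descent\<close>.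
    Subtracting that gain turns the term \<open>\<gamma> 1 k \<omega> / (8 * c)\<close> into
    \<open>- \<beta> 1 * \<gamma> 1 k \<omega>\<close>.\<close>
  define R where "R = (\<lambda>\<omega>. \<gamma> 1 k \<omega> + \<gamma> 1 k \<omega> / (8 * c) + \<beta> 3 * \<gamma> 3 k \<omega> - \<gamma> 2 k \<omega> / 4)"
  have "AE \<omega> in M. cond_exp M (history M m x \<Omega> k) (\<lambda>\<omega>. \<Sum>i=1..m. (infdist (x i (Suc k) \<omega>) X)\<^sup>2) \<omega>
      \<le> ereal (R \<omega> - \<gamma> 1 k \<omega> / (4 * c))"
  proof (rule cond_exp_descent)
    have inf: "(\<lambda>y. infdist y X) \<in> borel_measurable borel"
      by (intro borel_measurable_continuous_onI continuous_intros)
    show "(\<lambda>\<omega>. \<Sum>i=1..m. (infdist (x i (Suc k) \<omega>) X)\<^sup>2) \<in> borel_measurable M"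
      by (intro borel_measurable_sum borel_measurable_power measurable_compose[OF _ inf] measurable_iterates_M)
    show "R \<in> borel_measurable (history M m x \<Omega> k)"
      unfolding R_def using measurable_\<gamma>[of 1 k] measurable_\<gamma>[of 2 k] measurable_\<gamma>[of 3 k]
      by (intro borel_measurable_add borel_measurable_diff borel_measurable_divide borel_measurable_times
          borel_measurable_const) auto
    fix \<omega> assume \<omega>: "\<omega> \<in> space M"
    have "(infdist (x i (Suc k) \<omega>) X)\<^sup>2 + (infdist (v i k \<omega>) (Xs i (\<Omega> i k \<omega>)))\<^sup>2 / 4
        \<le> (infdist (v i k \<omega>) X)\<^sup>2 + (infdist (v i k \<omega>) X)\<^sup>2 / (8 * c) + (4 + 8 * c) * B\<^sup>2 * (\<alpha> k)\<^sup>2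
          - (norm (v i k \<omega> - p i k \<omega>))\<^sup>2 / 4" if i: "i \<in> {1..m}" for i
    proof -
      \<comment> \<open>With both free points of \<open>user_step\<close> at the projection of
        \<open>v\<close>, the cost difference and the distance to \<open>q\<close> vanish.\<close>
      have zX: "z i k \<omega> \<in> X" using closed_X constraints(2) by (rule closest_point_in_set)
      have "(infdist (x i (Suc k) \<omega>) X)\<^sup>2 \<le> (norm (x i (Suc k) \<omega> - z i k \<omega>))\<^sup>2"
        using infdist_le[OF zX, of "x i (Suc k) \<omega>"] by (simp add: dist_norm power_mono infdist_nonneg)
      then show ?thesis
        using user_step[OF i \<omega> zX zX, of k] infdist_closest_point[OF closed_X constraints(2), of "v i k \<omega>"]
        by simp
    qed
    then have "(\<Sum>i=1..m. (infdist (x i (Suc k) \<omega>) X)\<^sup>2 + (infdist (v i k \<omega>) (Xs i (\<Omega> i k \<omega>)))\<^sup>2 / 4)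
        \<le> (\<Sum>i=1..m. (infdist (v i k \<omega>) X)\<^sup>2 + (infdist (v i k \<omega>) X)\<^sup>2 / (8 * c) + (4 + 8 * c) * B\<^sup>2 * (\<alpha> k)\<^sup>2
          - (norm (v i k \<omega> - p i k \<omega>))\<^sup>2 / 4)"
      by (rule sum_mono)
    then show "(\<Sum>i=1..m. (infdist (x i (Suc k) \<omega>) X)\<^sup>2)
        + (\<Sum>i=1..m. (infdist (v i k \<omega>) (Xs i (\<Omega> i k \<omega>)))\<^sup>2 / 4) \<le> R \<omega>"
      by (simp add: R_def \<gamma>_simps \<beta>_def sum.distrib sum_subtractf sum_divide_distrib del: One_nat_def)
  qed (simp add: sum_nonneg)
  then show ?thesis
    using AE_space
  proof eventually_elim
    case (elim \<omega>)
    have "\<gamma> 1 k \<omega> \<le> (\<Sum>i=1..m. (infdist (x i k \<omega>) X)\<^sup>2)"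
      using sum_v_le(1)[OF elim(2)] by (simp add: \<gamma>_simps del: One_nat_def)
    moreover have "\<gamma> 1 k \<omega> / (4 * c) = \<gamma> 1 k \<omega> / (8 * c) + \<beta> 1 * \<gamma> 1 k \<omega>"
      using c_pos by (simp add: \<beta>_def field_simps del: One_nat_def)
    moreover have \<beta>_2: "\<beta> 2 = 1 / 4" by (simp add: \<beta>_def)
    ultimately have "R \<omega> - \<gamma> 1 k \<omega> / (4 * c)
        \<le> (\<Sum>i=1..m. (infdist (x i k \<omega>) X)\<^sup>2) - (\<Sum>j\<in>{1,2}. \<beta> j * \<gamma> j k \<omega>) + \<beta> 3 * \<gamma> 3 k \<omega>"
      by (simp add: R_def \<beta>_2 del: One_nat_def)
    then show ?case using elim(1) by (meson ereal_less_eq(3) order_trans)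
  qed
qed

lemma cond_exp_dist_le:
  "AE \<omega> in M. cond_exp M (history M m x \<Omega> k) (\<lambda>\<omega>. \<Sum>i=1..m. (norm (x i (Suc k) \<omega> - xstar))\<^sup>2) \<omega>
    \<le> ereal ((\<Sum>i=1..m. (norm (x i k \<omega> - xstar))\<^sup>2) - (\<Sum>j\<in>{1,2,5}. \<beta> j * \<gamma> j k \<omega>) + (\<Sum>j\<in>{3,4}. \<beta> j * \<gamma> j k \<omega>))"
proof -
  define N where "N = (\<lambda>\<omega>. \<Sum>i=1..m. (norm (v i k \<omega> - xstar))\<^sup>2)"
  define R where "R = (\<lambda>\<omega>. N \<omega> + \<gamma> 1 k \<omega> / (8 * c) + \<beta> 3 * \<gamma> 3 k \<omega> + \<beta> 4 * \<gamma> 4 k \<omega>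
    - \<gamma> 2 k \<omega> / 4 - \<beta> 5 * \<gamma> 5 k \<omega>)"
  have "AE \<omega> in M. cond_exp M (history M m x \<Omega> k) (\<lambda>\<omega>. \<Sum>i=1..m. (norm (x i (Suc k) \<omega> - xstar))\<^sup>2) \<omega>
      \<le> ereal (R \<omega> - \<gamma> 1 k \<omega> / (4 * c))"
  proof (rule cond_exp_descent)
    show "(\<lambda>\<omega>. \<Sum>i=1..m. (norm (x i (Suc k) \<omega> - xstar))\<^sup>2) \<in> borel_measurable M"
      by (intro borel_measurable_sum borel_measurable_power measurable_compose[OF _ borel_measurable_norm] borel_measurable_diff
          borel_measurable_const measurable_iterates_M)
    have "N \<in> borel_measurable (history M m x \<Omega> k)"
      unfolding N_def by (intro borel_measurable_sum borel_measurable_power measurable_compose[OF _ borel_measurable_norm]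
          borel_measurable_diff borel_measurable_const measurable_v)
    then show "R \<in> borel_measurable (history M m x \<Omega> k)"
      unfolding R_def
      using measurable_\<gamma>[of 1 k] measurable_\<gamma>[of 2 k] measurable_\<gamma>[of 3 k] measurable_\<gamma>[of 4 k] measurable_\<gamma>[of 5 k]
      by (intro borel_measurable_add borel_measurable_diff borel_measurable_divide borel_measurable_times
          borel_measurable_const) auto
    fix \<omega> assume \<omega>: "\<omega> \<in> space M"
    \<comment> \<open>The point is common to all users, so that the sum of the individual cost
      differences is a difference of total costs.\<close>
    define q where "q = average m (\<lambda>i. z i k \<omega>)"
    have "(norm (x i (Suc k) \<omega> - xstar))\<^sup>2 + (infdist (v i k \<omega>) (Xs i (\<Omega> i k \<omega>)))\<^sup>2 / 4
        \<le> (norm (v i k \<omega> - xstar))\<^sup>2 + (infdist (v i k \<omega>) X)\<^sup>2 / (8 * c) + (4 + 8 * c) * B\<^sup>2 * (\<alpha> k)\<^sup>2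
          - (norm (v i k \<omega> - p i k \<omega>))\<^sup>2 / 4
          + 2 * \<alpha> k * (f i xstar - f i q) + 2 * \<alpha> k * B * norm (z i k \<omega> - q)" if i: "i \<in> {1..m}" for i
      using user_step[OF i \<omega> total_cost_xstar(1) average_z_in, of k k \<omega>] by (simp add: q_def)
    then have "(\<Sum>i=1..m. (norm (x i (Suc k) \<omega> - xstar))\<^sup>2 + (infdist (v i k \<omega>) (Xs i (\<Omega> i k \<omega>)))\<^sup>2 / 4)
        \<le> (\<Sum>i=1..m. (norm (v i k \<omega> - xstar))\<^sup>2 + (infdist (v i k \<omega>) X)\<^sup>2 / (8 * c) + (4 + 8 * c) * B\<^sup>2 * (\<alpha> k)\<^sup>2
          - (norm (v i k \<omega> - p i k \<omega>))\<^sup>2 / 4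
          + 2 * \<alpha> k * (f i xstar - f i q) + 2 * \<alpha> k * B * norm (z i k \<omega> - q))"
      by (rule sum_mono)
    also have "\<dots> = N \<omega> + \<gamma> 1 k \<omega> / (8 * c) + \<beta> 3 * \<gamma> 3 k \<omega> - \<gamma> 2 k \<omega> / 4 - \<beta> 5 * \<gamma> 5 k \<omega>
        + 2 * \<alpha> k * B * (\<Sum>i=1..m. norm (z i k \<omega> - q))"
      by (simp add: N_def \<gamma>_simps \<beta>_def sum.distrib sum_subtractf sum_divide_distrib total_cost_def
          q_def sum_distrib_left algebra_simps del: One_nat_def)
    \<comment> \<open>Nonexpansiveness of the projection onto \<open>X\<close> carries the
      disagreement of the \<open>z\<close> back to that of the \<open>v\<close>.\<close>
    also have "2 * \<alpha> k * B * (\<Sum>i=1..m. norm (z i k \<omega> - q)) \<le> \<beta> 4 * \<gamma> 4 k \<omega>"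
    proof -
      have "(\<Sum>i=1..m. norm (z i k \<omega> - q))
          \<le> 2 * (\<Sum>i=1..m. norm (v i k \<omega> - average m (\<lambda>i. v i k \<omega>)))"
        unfolding q_def
        using closest_point_lipschitz[OF convex_X closed_X constraints(2)]
        by (intro sum_norm_average_le[OF users]) (simp add: dist_norm)
      then have "2 * \<alpha> k * B * (\<Sum>i=1..m. norm (z i k \<omega> - q))
          \<le> 2 * \<alpha> k * B * (2 * (\<Sum>i=1..m. norm (v i k \<omega> - average m (\<lambda>i. v i k \<omega>))))"
        using steps(1)[of k] B_pos by (intro mult_left_mono) auto
      then show ?thesis by (simp add: \<gamma>_simps \<beta>_def algebra_simps)
    qed
    finally show "(\<Sum>i=1..m. (norm (x i (Suc k) \<omega> - xstar))\<^sup>2)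
        + (\<Sum>i=1..m. (infdist (v i k \<omega>) (Xs i (\<Omega> i k \<omega>)))\<^sup>2 / 4) \<le> R \<omega>"
      by (simp add: R_def sum.distrib)
  qed (simp add: sum_nonneg)
  then show ?thesis
    using AE_space
  proof eventually_elim
    case (elim \<omega>)
    have "N \<omega> \<le> (\<Sum>i=1..m. (norm (x i k \<omega> - xstar))\<^sup>2)"
      using sum_v_le(2)[OF elim(2)] by (simp add: N_def)
    moreover have "\<gamma> 1 k \<omega> / (4 * c) = \<gamma> 1 k \<omega> / (8 * c) + \<beta> 1 * \<gamma> 1 k \<omega>"
      using c_pos by (simp add: \<beta>_def field_simps del: One_nat_def)
    moreover have \<beta>_2: "\<beta> 2 = 1 / 4" by (simp add: \<beta>_def)
    ultimately have "R \<omega> - \<gamma> 1 k \<omega> / (4 * c)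
        \<le> (\<Sum>i=1..m. (norm (x i k \<omega> - xstar))\<^sup>2) - (\<Sum>j\<in>{1,2,5}. \<beta> j * \<gamma> j k \<omega>) + (\<Sum>j\<in>{3,4}. \<beta> j * \<gamma> j k \<omega>)"
      by (simp add: R_def \<beta>_2 del: One_nat_def)
    then show ?case using elim(1) by (meson ereal_less_eq(3) order_trans)
  qed
qed


section \<open>Summability\<close>

text \<open>The projection moves \<open>p\<close> by its distance to the chosen set, which is at
  most its distance to the smaller set \<open>X\<close>; passing through \<open>p\<close> and
  \<open>v\<close> costs \<open>r\<close> twice.\<close>

lemma x_diff_v_le:
  assumes i: "i \<in> {1..m}" and \<omega>: "\<omega> \<in> space M"
  shows "(norm (x i (Suc k) \<omega> - v i k \<omega>))\<^sup>2
    \<le> 2 * (infdist (v i k \<omega>) X)\<^sup>2 + 8 * (norm (v i k \<omega> - p i k \<omega>))\<^sup>2"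
proof -
  define C where "C = Xs i (\<Omega> i k \<omega>)"
  define r where "r = norm (v i k \<omega> - p i k \<omega>)"
  have "\<Omega> i k \<omega> \<in> I i" using selection_in[OF i \<omega>] .
  then have C: "closed C" "X \<subseteq> C"
    using constraints(1)[OF i] feasible_subset[OF i] by (auto simp: C_def)
  then have "C \<noteq> {}" using constraints(2) by auto
  have "norm (x i (Suc k) \<omega> - p i k \<omega>) = infdist (p i k \<omega>) C"
    using infdist_closest_point[OF C(1) \<open>C \<noteq> {}\<close>] by (simp add: x_Suc[OF i \<omega>] C_def norm_minus_commute)
  also have "\<dots> \<le> infdist (p i k \<omega>) X"
    using C(2) constraints(2) by (rule infdist_mono)
  also have "\<dots> \<le> infdist (v i k \<omega>) X + r"
    using infdist_triangle[of "p i k \<omega>" X "v i k \<omega>"] by (simp add: r_def dist_norm norm_minus_commute)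
  finally have "norm (x i (Suc k) \<omega> - v i k \<omega>) \<le> infdist (v i k \<omega>) X + 2 * r"
    using norm_triangle_ineq[of "x i (Suc k) \<omega> - p i k \<omega>" "p i k \<omega> - v i k \<omega>"]
    by (simp add: r_def norm_minus_commute)
  then have "(norm (x i (Suc k) \<omega> - v i k \<omega>))\<^sup>2 \<le> (infdist (v i k \<omega>) X + 2 * r)\<^sup>2"
    by (simp add: power_mono)
  also have "\<dots> \<le> 2 * (infdist (v i k \<omega>) X)\<^sup>2 + 8 * r\<^sup>2"
    using power2_add_le[of 1 "infdist (v i k \<omega>) X" "2 * r"] by (simp add: power_mult_distrib)
  finally show ?thesis by (simp add: r_def)
qed

definition t :: real where "t = w0 / (2 * real m ^ 5)"

lemma t_pos: "0 < t"
  using w0(1) users by (simp add: t_def)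

abbreviation disagreement :: "nat \<Rightarrow> 'w \<Rightarrow> real" where
  "disagreement k \<omega> \<equiv> spread m (\<lambda>i. v i k \<omega>)"

text \<open>The points \<open>v\<close> at time \<open>k + 1\<close> average the points
  \<open>x\<close> at \<open>k + 1\<close>, which are a perturbation of \<open>v\<close> at time
  \<open>k\<close>. The weights and the graph are therefore those of time
  \<open>k + 1\<close>.\<close>

lemma disagreement_step:
  assumes \<omega>: "\<omega> \<in> space M"
  shows "disagreement (Suc k) \<omega> + t\<^sup>2 * disagreement k \<omega>
    \<le> disagreement k \<omega> + (1 / t) * (2 * \<gamma> 1 k \<omega> + 8 * \<gamma> 2 k \<omega>)"
proof -
  have "disagreement (Suc k) \<omega> = spread m (\<lambda>i. \<Sum>j=1..m. w i j (Suc k) *\<^sub>R x j (Suc k) \<omega>)"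
    using v_eq[OF _ \<omega>] by (intro spread_cong) auto
  moreover have "spread m (\<lambda>i. \<Sum>j=1..m. w i j (Suc k) *\<^sub>R x j (Suc k) \<omega>) + t\<^sup>2 * disagreement k \<omega>
      \<le> disagreement k \<omega> + (1 / t) * (\<Sum>i=1..m. (norm (x i (Suc k) \<omega> - v i k \<omega>))\<^sup>2)"
    unfolding t_def
  proof (rule spread_averaging_step[OF users w0(1,2) weights(1,3,4) connected[of "Suc k"] edges(1)])
    show "w0 \<le> w i j (Suc k)" if "(i, j) \<in> E (Suc k)" for i j
      using that edges(1)[of "Suc k"] by (intro w0(3)) (auto simp: neighbours_def)
    show "w0 \<le> w i i (Suc k)" if "i \<in> {1..m}" for i
      using that edges(2)[OF that] by (intro w0(3)) (auto simp: neighbours_def)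
  qed
  moreover have "(1 / t) * (\<Sum>i=1..m. (norm (x i (Suc k) \<omega> - v i k \<omega>))\<^sup>2)
      \<le> (1 / t) * (2 * \<gamma> 1 k \<omega> + 8 * \<gamma> 2 k \<omega>)"
  proof (rule mult_left_mono)
    have "(\<Sum>i=1..m. (norm (x i (Suc k) \<omega> - v i k \<omega>))\<^sup>2)
        \<le> (\<Sum>i=1..m. 2 * (infdist (v i k \<omega>) X)\<^sup>2 + 8 * (norm (v i k \<omega> - p i k \<omega>))\<^sup>2)"
      using x_diff_v_le[OF _ \<omega>] by (rule sum_mono)
    then show "(\<Sum>i=1..m. (norm (x i (Suc k) \<omega> - v i k \<omega>))\<^sup>2) \<le> 2 * \<gamma> 1 k \<omega> + 8 * \<gamma> 2 k \<omega>"
      by (simp add: \<gamma>_simps sum.distrib sum_distrib_left del: One_nat_def)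
  qed (use t_pos in simp)
  ultimately show ?thesis by linarith
qed

section \<open>Localization to bounded initial points\<close>

definition initial_ball :: "nat \<Rightarrow> 'w set" where
  "initial_ball N = {\<omega> \<in> space M. \<forall>i\<in>{1..m}. norm (x i 0 \<omega>) \<le> real N}"

lemma initial_ball_history: "initial_ball N \<in> sets (history M m x \<Omega> k)"
proof -
  let ?F = "history M m x \<Omega> k"
  have "{\<omega> \<in> space ?F. norm (x i 0 \<omega>) \<le> real N} \<in> sets ?F" if "i \<in> {1..m}" for i
    using measurable_compose[OF measurable_initial_history[OF that] borel_measurable_norm]
    by (intro borel_measurable_le borel_measurable_const)
  then have "{\<omega> \<in> space ?F. \<forall>i\<in>{1..m}. norm (x i 0 \<omega>) \<le> real N} \<in> sets ?F"
    by (intro sets.sets_Collect_finite_All) auto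
  then show ?thesis by (simp add: initial_ball_def)
qed

lemma initial_ball_events: "initial_ball N \<in> events"
  using initial_ball_history[of N 0] subalgebra_history[of 0] by (auto simp: subalgebra_def)

lemma UN_initial_ball: "space M \<subseteq> (\<Union>N. initial_ball N)"
proof
  fix \<omega> assume "\<omega> \<in> space M"
  define N where "N = nat \<lceil>\<Sum>i=1..m. norm (x i 0 \<omega>)\<rceil>"
  have "norm (x i 0 \<omega>) \<le> real N" if "i \<in> {1..m}" for i
  proof -
    have "norm (x i 0 \<omega>) \<le> (\<Sum>i=1..m. norm (x i 0 \<omega>))"
      using that by (intro member_le_sum) auto
    also have "\<dots> \<le> real N" unfolding N_def by (rule real_nat_ceiling_ge)
    finally show ?thesis .
  qed
  then show "\<omega> \<in> (\<Union>N. initial_ball N)" using \<open>\<omega> \<in> space M\<close>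
    by (auto simp: initial_ball_def intro!: exI[of _ N])
qed

lemma initial_dist_le:
  assumes "\<omega> \<in> initial_ball N"
  shows "(\<Sum>i=1..m. (norm (x i 0 \<omega> - y))\<^sup>2) \<le> real m * (real N + norm y)\<^sup>2"
proof -
  have "(norm (x i 0 \<omega> - y))\<^sup>2 \<le> (real N + norm y)\<^sup>2" if "i \<in> {1..m}" for i
  proof -
    have "norm (x i 0 \<omega> - y) \<le> norm (x i 0 \<omega>) + norm y" by (rule norm_triangle_ineq4)
    also have "\<dots> \<le> real N + norm y" using assms that by (simp add: initial_ball_def)
    finally show ?thesis by (simp add: power_mono)
  qed
  then have "(\<Sum>i=1..m. (norm (x i 0 \<omega> - y))\<^sup>2) \<le> (\<Sum>i=1..m. (real N + norm y)\<^sup>2)"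
    by (rule sum_mono)
  then show ?thesis by simp
qed

lemma measurable_\<gamma>_M: "j \<in> {1..5} \<Longrightarrow> \<gamma> j k \<in> borel_measurable M"
  by (rule measurable_from_subalg[OF subalgebra_history measurable_\<gamma>])

lemma measurable_weighted_\<gamma>:
  "J \<subseteq> {1..5} \<Longrightarrow> (\<lambda>\<omega>. \<Sum>j\<in>J. \<beta> j * \<gamma> j k \<omega>) \<in> borel_measurable M"
  by (intro borel_measurable_sum borel_measurable_times borel_measurable_const measurable_\<gamma>_M) auto

lemma weighted_\<gamma>_nonneg: "J \<subseteq> {1..5} \<Longrightarrow> 0 \<le> (\<Sum>j\<in>J. \<beta> j * \<gamma> j k \<omega>)"
  using \<beta>_pos by (intro sum_nonneg mult_nonneg_nonneg \<gamma>_nonneg) (auto intro: less_imp_le)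

text \<open>The common argument for both conditional inequalities: integrate over the initial ball,
  telescope in \<open>k\<close>, and isolate one of the summed gains.\<close>

lemma restricted_summable_of_cond_exp:
  assumes J: "J \<subseteq> {1..5}" and K: "K \<subseteq> {1..5}"
    and Y: "\<And>k. Y k \<in> borel_measurable M" "\<And>k \<omega>. 0 \<le> Y k \<omega>" "\<And>\<omega>. \<omega> \<in> initial_ball N \<Longrightarrow> Y 0 \<omega> \<le> C"
    and descent: "\<And>k. AE \<omega> in M. cond_exp M (history M m x \<Omega> k) (Y (Suc k)) \<omega>
      \<le> ereal (Y k \<omega> - (\<Sum>j\<in>J. \<beta> j * \<gamma> j k \<omega>) + (\<Sum>j\<in>K. \<beta> j * \<gamma> j k \<omega>))"
    and K_sum: "restricted_summable M (initial_ball N) (\<lambda>k \<omega>. \<Sum>j\<in>K. \<beta> j * \<gamma> j k \<omega>)"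
    and j: "j \<in> J"
  shows "restricted_summable M (initial_ball N) (\<gamma> j)"
proof -
  have "restricted_summable M (initial_ball N) (\<lambda>k \<omega>. \<Sum>j\<in>J. \<beta> j * \<gamma> j k \<omega>)"
  proof (rule restricted_summable_descent[where Y = Y])
    fix k
    interpret F: finite_measure_subalgebra M "history M m x \<Omega> k"
      by unfold_locales (rule subalgebra_history)
    show "(\<integral>\<^sup>+\<omega>\<in>initial_ball N. ennreal (Y (Suc k) \<omega>) \<partial>M)
        + (\<integral>\<^sup>+\<omega>\<in>initial_ball N. ennreal (\<Sum>j\<in>J. \<beta> j * \<gamma> j k \<omega>) \<partial>M)
      \<le> (\<integral>\<^sup>+\<omega>\<in>initial_ball N. ennreal (Y k \<omega>) \<partial>M)
        + (\<integral>\<^sup>+\<omega>\<in>initial_ball N. ennreal (\<Sum>j\<in>K. \<beta> j * \<gamma> j k \<omega>) \<partial>M)"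
      by (rule F.cond_exp_set_integral_le[OF initial_ball_history Y(1) measurable_weighted_\<gamma>[OF J] Y(1)
          measurable_weighted_\<gamma>[OF K] weighted_\<gamma>_nonneg[OF J] Y(2) weighted_\<gamma>_nonneg[OF K] descent])
  next
    show "(\<integral>\<^sup>+\<omega>\<in>initial_ball N. ennreal (Y 0 \<omega>) \<partial>M) < \<infinity>"
      using Y(3) by (intro set_nn_integral_bounded[OF initial_ball_events])
  qed (rule K_sum)
  \<comment> \<open>All terms of the sum are nonnegative, so each one is dominated by it; division
    by \<open>\<beta> j\<close> isolates \<open>\<gamma> j\<close>.\<close>
  then have "restricted_summable M (initial_ball N) (\<lambda>k \<omega>. (1 / \<beta> j) * (\<Sum>j\<in>J. \<beta> j * \<gamma> j k \<omega>))"
    using measurable_weighted_\<gamma>[OF J] \<beta>_pos[of j]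
    by (intro restricted_summable_cmult initial_ball_events) (auto intro: less_imp_le)
  then show ?thesis
  proof (rule restricted_summable_mono)
    fix k \<omega>
    have "finite J" using J by (rule finite_subset) simp
    then have "\<beta> j * \<gamma> j k \<omega> \<le> (\<Sum>j\<in>J. \<beta> j * \<gamma> j k \<omega>)"
      using j J \<beta>_pos by (intro member_le_sum mult_nonneg_nonneg \<gamma>_nonneg) (auto intro: less_imp_le)
    then show "\<gamma> j k \<omega> \<le> (1 / \<beta> j) * (\<Sum>j\<in>J. \<beta> j * \<gamma> j k \<omega>)"
      using \<beta>_pos[of j] by (simp add: field_simps)
  qed
qed

lemma restricted_summable_\<gamma>_3: "restricted_summable M (initial_ball N) (\<gamma> 3)"
  unfolding \<gamma>_simps
  using restricted_summable_const[OF steps(2) _ initial_ball_events] by simp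

lemma restricted_summable_\<gamma>_12:
  assumes "j \<in> {1, 2}"
  shows "restricted_summable M (initial_ball N) (\<gamma> j)"
proof (rule restricted_summable_of_cond_exp[where J = "{1, 2}" and K = "{3}"])
  show "(\<lambda>\<omega>. \<Sum>i=1..m. (infdist (x i k \<omega>) X)\<^sup>2) \<in> borel_measurable M" for k
    by (intro borel_measurable_sum borel_measurable_power measurable_compose[OF measurable_iterates_M(1)]
        borel_measurable_continuous_onI continuous_intros)
  show "(\<Sum>i=1..m. (infdist (x i 0 \<omega>) X)\<^sup>2) \<le> real m * (real N + norm xstar)\<^sup>2"
    if "\<omega> \<in> initial_ball N" for \<omega>
  proof -
    have "(\<Sum>i=1..m. (infdist (x i 0 \<omega>) X)\<^sup>2) \<le> (\<Sum>i=1..m. (norm (x i 0 \<omega> - xstar))\<^sup>2)"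
      using infdist_le[OF total_cost_xstar(1)]
      by (intro sum_mono power_mono infdist_nonneg) (simp add: dist_norm)
    then show ?thesis using initial_dist_le[OF that, of xstar] by simp
  qed
  show "AE \<omega> in M. cond_exp M (history M m x \<Omega> k) (\<lambda>\<omega>. \<Sum>i=1..m. (infdist (x i (Suc k) \<omega>) X)\<^sup>2) \<omega>
    \<le> ereal ((\<Sum>i=1..m. (infdist (x i k \<omega>) X)\<^sup>2) - (\<Sum>j\<in>{1,2}. \<beta> j * \<gamma> j k \<omega>) + (\<Sum>j\<in>{3}. \<beta> j * \<gamma> j k \<omega>))" for k
    using cond_exp_infdist_le[of k] by simp
  show "restricted_summable M (initial_ball N) (\<lambda>k \<omega>. \<Sum>j\<in>{3}. \<beta> j * \<gamma> j k \<omega>)"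
    using restricted_summable_cmult[OF restricted_summable_\<gamma>_3 initial_ball_events measurable_\<gamma>_M
        less_imp_le[OF \<beta>_pos]] by simp
qed (use assms in \<open>auto intro: sum_nonneg\<close>)

lemma measurable_disagreement: "disagreement k \<in> borel_measurable M"
  unfolding spread_def average_def
  by (intro borel_measurable_sum borel_measurable_power measurable_compose[OF _ borel_measurable_norm]
      borel_measurable_diff borel_measurable_scaleR borel_measurable_const measurable_iterates_M(2))

lemma restricted_summable_disagreement: "restricted_summable M (initial_ball N) disagreement"
proof -
  let ?e = "\<lambda>k \<omega>. (1 / t) * (2 * \<gamma> 1 k \<omega> + 8 * \<gamma> 2 k \<omega>)"
  have \<gamma>: "\<gamma> 1 k \<in> borel_measurable M" "\<gamma> 2 k \<in> borel_measurable M"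
    "0 \<le> \<gamma> 1 k \<omega>" "0 \<le> \<gamma> 2 k \<omega>" for k \<omega>
    by (auto intro!: measurable_\<gamma>_M \<gamma>_nonneg simp del: One_nat_def)
  have e: "restricted_summable M (initial_ball N) ?e"
  proof (intro restricted_summable_cmult restricted_summable_add initial_ball_events)
    show "restricted_summable M (initial_ball N) (\<gamma> 1)" "restricted_summable M (initial_ball N) (\<gamma> 2)"
      by (rule restricted_summable_\<gamma>_12; simp)+
  qed (use \<gamma> t_pos in \<open>auto intro!: borel_measurable_add borel_measurable_times simp del: One_nat_def\<close>)
  have e_meas: "?e k \<in> borel_measurable M" for k
    by (intro borel_measurable_add borel_measurable_times borel_measurable_const \<gamma>)
  have "restricted_summable M (initial_ball N) (\<lambda>k \<omega>. t\<^sup>2 * disagreement k \<omega>)"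
  proof (rule restricted_summable_descent[where Y = disagreement])
    show "(\<integral>\<^sup>+\<omega>\<in>initial_ball N. ennreal (disagreement (Suc k) \<omega>) \<partial>M)
        + (\<integral>\<^sup>+\<omega>\<in>initial_ball N. ennreal (t\<^sup>2 * disagreement k \<omega>) \<partial>M)
      \<le> (\<integral>\<^sup>+\<omega>\<in>initial_ball N. ennreal (disagreement k \<omega>) \<partial>M)
        + (\<integral>\<^sup>+\<omega>\<in>initial_ball N. ennreal (?e k \<omega>) \<partial>M)" for k
      by (rule set_nn_integral_add_le[OF initial_ball_events measurable_disagreement _ measurable_disagreement e_meas _ _ _ _ disagreement_step])
        (use measurable_disagreement \<gamma> t_pos in \<open>auto intro!: spread_nonneg mult_nonneg_nonneg simp del: One_nat_def\<close>)
    show "(\<integral>\<^sup>+\<omega>\<in>initial_ball N. ennreal (disagreement 0 \<omega>) \<partial>M) < \<infinity>"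
    proof (rule set_nn_integral_bounded[OF initial_ball_events])
      \<comment> \<open>At time 0 the spread of \<open>v\<close> is at most its second moment about
        the origin, which averaging bounds by that of the initial points.\<close>
      fix \<omega> assume "\<omega> \<in> initial_ball N"
      moreover from this have "\<omega> \<in> space M" by (simp add: initial_ball_def)
      ultimately show "disagreement 0 \<omega> \<le> real m * (real N + norm (0::'a))\<^sup>2"
        using spread_le[OF users, of "\<lambda>i. v i 0 \<omega>" 0] sum_v_le(2)[of \<omega> 0 0] initial_dist_le[of \<omega> N 0]
        by linarith
    qed
  qed (rule e)
  then have "restricted_summable M (initial_ball N) (\<lambda>k \<omega>. (1 / t\<^sup>2) * (t\<^sup>2 * disagreement k \<omega>))"
    by (rule restricted_summable_cmult[OF _ initial_ball_events]) (use measurable_disagreement in auto)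
  then show ?thesis using t_pos by simp
qed

lemma restricted_summable_\<gamma>_4: "restricted_summable M (initial_ball N) (\<gamma> 4)"
proof -
  have "restricted_summable M (initial_ball N) (\<lambda>k \<omega>. real m * \<gamma> 3 k \<omega> + disagreement k \<omega>)"
    by (intro restricted_summable_add restricted_summable_cmult restricted_summable_\<gamma>_3
        restricted_summable_disagreement initial_ball_events measurable_\<gamma>_M measurable_disagreement
        borel_measurable_times borel_measurable_const mult_nonneg_nonneg \<gamma>_nonneg spread_nonneg) auto
  then show ?thesis
  proof (rule restricted_summable_mono)
    fix k \<omega>
    \<comment> \<open>Applied once per user, which accounts for the factor \<open>m\<close> in front
      of \<open>\<gamma> 3\<close>.\<close>
    have "\<alpha> k * r \<le> (\<alpha> k)\<^sup>2 + r\<^sup>2" for r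
      using sum_squares_bound[of "\<alpha> k" r] zero_le_power2[of "\<alpha> k"] zero_le_power2[of r] by linarith
    then have "(\<Sum>i=1..m. \<alpha> k * norm (v i k \<omega> - average m (\<lambda>i. v i k \<omega>)))
        \<le> (\<Sum>i=1..m. (\<alpha> k)\<^sup>2 + (norm (v i k \<omega> - average m (\<lambda>i. v i k \<omega>)))\<^sup>2)"
      by (intro sum_mono)
    then show "\<gamma> 4 k \<omega> \<le> real m * \<gamma> 3 k \<omega> + disagreement k \<omega>"
      by (simp add: \<gamma>_simps spread_def sum.distrib sum_distrib_left)
  qed
qed

lemma restricted_summable_\<gamma>_5: "restricted_summable M (initial_ball N) (\<gamma> 5)"
proof (rule restricted_summable_of_cond_exp[where J = "{1, 2, 5}" and K = "{3, 4}"])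
  show "(\<lambda>\<omega>. \<Sum>i=1..m. (norm (x i k \<omega> - xstar))\<^sup>2) \<in> borel_measurable M" for k
    by (intro borel_measurable_sum borel_measurable_power measurable_compose[OF _ borel_measurable_norm]
        borel_measurable_diff borel_measurable_const measurable_iterates_M(1))
  have "restricted_summable M (initial_ball N) (\<lambda>k \<omega>. \<beta> 3 * \<gamma> 3 k \<omega> + \<beta> 4 * \<gamma> 4 k \<omega>)"
    by (intro restricted_summable_add restricted_summable_cmult restricted_summable_\<gamma>_3
        restricted_summable_\<gamma>_4 initial_ball_events measurable_\<gamma>_M
        borel_measurable_times borel_measurable_const mult_nonneg_nonneg \<gamma>_nonneg less_imp_le[OF \<beta>_pos]) auto
  then show "restricted_summable M (initial_ball N) (\<lambda>k \<omega>. \<Sum>j\<in>{3, 4}. \<beta> j * \<gamma> j k \<omega>)"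
    by simp
qed (use cond_exp_dist_le initial_dist_le in \<open>auto intro: sum_nonneg\<close>)

lemma AE_summable_\<gamma>:
  assumes "j \<in> {1..5}"
  shows "AE \<omega> in M. summable (\<lambda>k. \<gamma> j k \<omega>)"
proof (rule AE_summable_if_restricted_integrals[OF measurable_\<gamma>_M[OF assms] \<gamma>_nonneg[OF assms]
      initial_ball_events UN_initial_ball])
  have "j = 1 \<or> j = 2 \<or> j = 3 \<or> j = 4 \<or> j = 5" using assms by auto
  then have "restricted_summable M (initial_ball N) (\<gamma> j)" for N
    using restricted_summable_\<gamma>_12 restricted_summable_\<gamma>_3 restricted_summable_\<gamma>_4
      restricted_summable_\<gamma>_5 by blast
  then show "(\<Sum>k. \<integral>\<^sup>+\<omega>\<in>initial_ball N. ennreal (\<gamma> j k \<omega>) \<partial>M) < \<infinity>" for N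
    by (simp add: restricted_summable_def)
qed

end

theorem proposition3p1:
  fixes M :: "'w measure" and m n :: nat and I :: "nat \<Rightarrow> nat set"
    and Xs :: "nat \<Rightarrow> nat \<Rightarrow> (real ^ 'd) set" and f :: "nat \<Rightarrow> real ^ 'd \<Rightarrow> real"
    and E :: "nat \<Rightarrow> (nat \<times> nat) set" and w :: "nat \<Rightarrow> nat \<Rightarrow> nat \<Rightarrow> real"
    and \<alpha> :: "nat \<Rightarrow> real" and \<Omega> :: "nat \<Rightarrow> nat \<Rightarrow> 'w \<Rightarrow> nat"
    and x v :: "nat \<Rightarrow> nat \<Rightarrow> 'w \<Rightarrow> real ^ 'd" and xstar :: "real ^ 'd"
  assumes M: "prob_space M"
    and users: "m \<ge> 1"
    and indices: "(\<Union>i\<in>{1..m}. I i) = {1..n}" "disjoint_family_on I {1..m}"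
      "\<And>i. i \<in> {1..m} \<Longrightarrow> I i \<noteq> {}"
    and edges: "\<And>k. E k \<subseteq> {1..m} \<times> {1..m}" "\<And>i k. i \<in> {1..m} \<Longrightarrow> (i, i) \<in> E k"
    and selection: "\<And>i k. i \<in> {1..m} \<Longrightarrow> \<Omega> i k \<in> measurable M (count_space (I i))"
    and initial: "\<And>i. i \<in> {1..m} \<Longrightarrow> x i 0 \<in> borel_measurable M"
    and constraints: "\<And>i j. i \<in> {1..m} \<Longrightarrow> j \<in> I i \<Longrightarrow> closed (Xs i j) \<and> convex (Xs i j)"
      "feasible m I Xs \<noteq> {}"
    and costs: "\<And>i. i \<in> {1..m} \<Longrightarrow> convex_on UNIV (f i)"
      "\<And>i. i \<in> {1..m} \<Longrightarrow>
         \<exists>B::real. \<forall>y\<in>user_feasible I Xs i. \<forall>g\<in>subdifferential (f i) y. norm g \<le> B"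
    and connected: "\<exists>Q\<ge>1. \<forall>k. strongly_connected (user_graph m (\<Inter>l\<in>{..<Q}. E (k + l)))"
    and independent:
      "prob_space.indep_vars M (\<lambda>(i, k). count_space (I i)) (\<lambda>(i, k). \<Omega> i k) ({1..m} \<times> UNIV)"
      "prob_space.indep_set M (sigma_sets (space M) (selection_events M m \<Omega> UNIV))
         (sigma_sets (space M) (initial_events M m x))"
    and identical: "\<And>i k l. i \<in> {1..m} \<Longrightarrow>
         distr M (count_space (I i)) (\<Omega> i k) = distr M (count_space (I i)) (\<Omega> i l)"
    and positive: "\<And>i j k. i \<in> {1..m} \<Longrightarrow> j \<in> I i \<Longrightarrow> measure M {\<omega> \<in> space M. \<Omega> i k \<omega> = j} > 0"
    and regularity: "\<exists>c>0. \<forall>i\<in>{1..m}. \<forall>y k.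
         (infdist y (feasible m I Xs))\<^sup>2 \<le> c * (LINT \<omega>|M. (infdist y (Xs i (\<Omega> i k \<omega>)))\<^sup>2)"
    and weights: "\<And>i j k. i \<in> {1..m} \<Longrightarrow> j \<in> {1..m} \<Longrightarrow> w i j k \<ge> 0"
      "\<And>i j k. i \<in> {1..m} \<Longrightarrow> j \<in> {1..m} \<Longrightarrow> j \<notin> neighbours m E i k \<Longrightarrow> w i j k = 0"
      "\<And>i k. i \<in> {1..m} \<Longrightarrow> (\<Sum>j=1..m. w i j k) = 1"
      "\<And>j k. j \<in> {1..m} \<Longrightarrow> (\<Sum>i=1..m. w i j k) = 1"
      "\<exists>w0. 0 < w0 \<and> w0 < 1 \<and> (\<forall>i\<in>{1..m}. \<forall>k. \<forall>j\<in>neighbours m E i k. w i j k \<ge> w0)"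
    and steps: "\<And>k. \<alpha> k > 0" "\<not> summable \<alpha>" "summable (\<lambda>k. (\<alpha> k)\<^sup>2)"
    and xstar: "xstar \<in> solutions (total_cost m f) (feasible m I Xs)"
    and algorithm: "random_projected_proximal M m E w f Xs \<alpha> \<Omega> x v"
  shows "\<exists>\<beta> :: nat \<Rightarrow> real. (\<forall>j\<in>{1..5}. \<beta> j > 0) \<and>
    (let X = feasible m I Xs;
         \<gamma> = (\<lambda>j k \<omega>. gamma m f X (\<alpha> k) (\<lambda>i. v i k \<omega>) j)
     in
      (AE \<omega> in M. \<forall>k.
        cond_exp M (history M m x \<Omega> k) (\<lambda>\<omega>. \<Sum>i=1..m. (infdist (x i (k + 1) \<omega>) X)\<^sup>2) \<omega>
          \<le> ereal ((\<Sum>i=1..m. (infdist (x i k \<omega>) X)\<^sup>2)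
                    - (\<Sum>j\<in>{1,2}. \<beta> j * \<gamma> j k \<omega>) + \<beta> 3 * \<gamma> 3 k \<omega>) \<and>
        cond_exp M (history M m x \<Omega> k) (\<lambda>\<omega>. \<Sum>i=1..m. (norm (x i (k + 1) \<omega> - xstar))\<^sup>2) \<omega>
          \<le> ereal ((\<Sum>i=1..m. (norm (x i k \<omega> - xstar))\<^sup>2)
                    - (\<Sum>j\<in>{1,2,5}. \<beta> j * \<gamma> j k \<omega>) + (\<Sum>j\<in>{3,4}. \<beta> j * \<gamma> j k \<omega>))) \<and>
      (\<forall>j\<in>{1..5}. AE \<omega> in M. summable (\<lambda>k. \<gamma> j k \<omega>)))"
proof -
  obtain c where c: "0 < c" "\<forall>i\<in>{1..m}. \<forall>y k.
      (infdist y (feasible m I Xs))\<^sup>2 \<le> c * (LINT \<omega>|M. (infdist y (Xs i (\<Omega> i k \<omega>)))\<^sup>2)"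
    using regularity by blast
  obtain w0 where w0: "0 < w0" "w0 < 1" "\<forall>i\<in>{1..m}. \<forall>k. \<forall>j\<in>neighbours m E i k. w i j k \<ge> w0"
    using weights(5) by blast
  obtain b where b: "\<And>i y g. i \<in> {1..m} \<Longrightarrow> y \<in> user_feasible I Xs i \<Longrightarrow> g \<in> subdifferential (f i) y \<Longrightarrow> norm g \<le> b i"
    using costs(2) by metis
  \<comment> \<open>Absolute values make the sum dominate every \<open>b i\<close> whatever its
    sign; the added 1 ensures positivity.\<close>
  define B where "B = 1 + (\<Sum>i=1..m. \<bar>b i\<bar>)"
  have b_le: "b i \<le> B" if "i \<in> {1..m}" for i
    using member_le_sum[of i "{1..m}" "\<lambda>i. \<bar>b i\<bar>"] that by (simp add: B_def)
  obtain Q where Q: "Q \<ge> 1" "\<And>k. strongly_connected (user_graph m (\<Inter>l\<in>{..<Q}. E (k + l)))"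
    using connected by blast
  have sc: "strongly_connected (user_graph m (E k))" for k
  proof (rule strongly_connected_user_graph_mono[OF Q(2)[of k]])
    show "(\<Inter>l\<in>{..<Q}. E (k + l)) \<subseteq> E k"
      using INF_lower[of 0 "{..<Q}" "\<lambda>l. E (k + l)"] Q(1) by simp
  qed
  interpret random_proximal_network M m I Xs f E w \<alpha> \<Omega> x v xstar c w0 B
  proof (rule random_proximal_network.intro[OF M], rule random_proximal_network_axioms.intro)
    \<comment> \<open>Each index set lies in the finite range \<open>{1..n}\<close>.\<close>
    show "finite (I i)" if "i \<in> {1..m}" for i
      using indices(1) that by (metis UN_upper finite_atLeastAtMost finite_subset)
    show "0 < B" unfolding B_def by (intro add_pos_nonneg sum_nonneg) auto
    \<comment> \<open>A point feasible for the network is feasible for user \<open>i\<close>, so the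
      bound of that user applies.\<close>
    show "norm g \<le> B" if "i \<in> {1..m}" "y \<in> feasible m I Xs" "g \<in> subdifferential (f i) y" for i y g
      using b[OF that(1) _ that(3)] that(1,2) b_le[OF that(1)] by (fastforce simp: feasible_def)
  qed (fact assms sc c(1) w0(1,2) | (rule c(2)[rule_format] w0(3)[rule_format]; assumption))+
  \<comment> \<open>Each time has its own exceptional null set; countably many of them still form a
    null set.\<close>
  have "AE \<omega> in M. \<forall>k.
      cond_exp M (history M m x \<Omega> k) (\<lambda>\<omega>. \<Sum>i=1..m. (infdist (x i (k + 1) \<omega>) X)\<^sup>2) \<omega>
        \<le> ereal ((\<Sum>i=1..m. (infdist (x i k \<omega>) X)\<^sup>2) - (\<Sum>j\<in>{1,2}. \<beta> j * \<gamma> j k \<omega>) + \<beta> 3 * \<gamma> 3 k \<omega>) \<and>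
      cond_exp M (history M m x \<Omega> k) (\<lambda>\<omega>. \<Sum>i=1..m. (norm (x i (k + 1) \<omega> - xstar))\<^sup>2) \<omega>
        \<le> ereal ((\<Sum>i=1..m. (norm (x i k \<omega> - xstar))\<^sup>2) - (\<Sum>j\<in>{1,2,5}. \<beta> j * \<gamma> j k \<omega>)
          + (\<Sum>j\<in>{3,4}. \<beta> j * \<gamma> j k \<omega>))"
    unfolding AE_all_countable Suc_eq_plus1[symmetric]
    using cond_exp_infdist_le cond_exp_dist_le by (intro allI AE_conjI)
  then show ?thesis
    unfolding Let_def using \<beta>_pos AE_summable_\<gamma> by (intro exI[of _ \<beta>] conjI ballI)
qed

end
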